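(* Let $k\ge 2$, $3\le r\le 2k$ and $n\ge 100k$ be integers. Suppose that $G$ is an $n$-vertex graph that contains no cycle $C_{2k+1}$ of length $2k+1$ as a subgraph, and that \[ e(G)\ge \left\lfloor \frac{(n-r+1)^2}{4}\right\rfloor+\binom{r}{2}. \] Then $G\in \mathcal{G}_{n,r}$, unless $G$ is obtained from the balanced complete bipartite graph $T_{n-r+1,2}$ by suspending a complete graph $K_r$ (i.e., $G$ is the union of $T_{n-r+1,2}$ and $K_r$ sharing exactly one vertex).
   Context: $e(G)$ denotes the number of edges of $G$. $T_{m,2}$ denotes the complete bipartite graph on $m$ vertices whose two parts have sizes $\lfloor m/2\rfloor$ and $\lceil m/2\rceil$. A graph $H$ is said to be suspended on a graph $B$ if $H$ intersects $B$ in exactly one vertex. $\mathcal{G}_{n,r}$ is the family of $n$-vertex graphs that are obtained from a bipartite graph $B$ by suspending graphs $G_1,\dots,G_s$ on $B$ (for some $s\in\mathbb{N}$), i.e. the graph is $B\cup G_1\cup\dots\cup G_s$ with each $G_i$ meeting $B$ in exactly one vertex, where $\sum_{i=1}^s |V(G_i)\setminus V(B)|\le r-2$. *)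

theory Defs
  imports Main
begin

definition graph :: "'a set \<Rightarrow> 'a set set \<Rightarrow> bool" where
  "graph V E \<longleftrightarrow> finite V \<and> (\<forall>e\<in>E. e \<subseteq> V \<and> card e = 2)"

definition has_cycle :: "'a set \<Rightarrow> 'a set set \<Rightarrow> nat \<Rightarrow> bool" where
  "has_cycle V E L \<longleftrightarrow> (\<exists>vs. length vs = L \<and> distinct vs \<and> set vs \<subseteq> V \<and>
      (\<forall>i<L. {vs ! i, vs ! ((i + 1) mod L)} \<in> E))"

definition bipartite :: "'a set \<Rightarrow> 'a set set \<Rightarrow> bool" where
  "bipartite V E \<longleftrightarrow> (\<exists>X\<subseteq>V. \<forall>e\<in>E. card (e \<inter> X) = 1)"

definition G_family :: "nat \<Rightarrow> nat \<Rightarrow> 'a set \<Rightarrow> 'a set set \<Rightarrow> bool" where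
  "G_family n r V E \<longleftrightarrow> graph V E \<and> card V = n \<and>
     (\<exists>VB EB s (GV :: nat \<Rightarrow> 'a set) (GE :: nat \<Rightarrow> 'a set set).
        graph VB EB \<and> bipartite VB EB \<and>
        (\<forall>i<s. graph (GV i) (GE i) \<and> card (GV i \<inter> VB) = 1) \<and>
        V = VB \<union> (\<Union>i<s. GV i) \<and> E = EB \<union> (\<Union>i<s. GE i) \<and>
        (\<Sum>i<s. card (GV i - VB)) + 2 \<le> r)"

definition T_with_Kr :: "nat \<Rightarrow> nat \<Rightarrow> 'a set \<Rightarrow> 'a set set \<Rightarrow> bool" where
  "T_with_Kr n r V E \<longleftrightarrow>
     (\<exists>X Y K. X \<inter> Y = {} \<and> finite X \<and> finite Y \<and> finite K \<and>
        card X = (n - r + 1) div 2 \<and> card Y = (n - r + 1) - (n - r + 1) div 2 \<and>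
        card K = r \<and> card (K \<inter> (X \<union> Y)) = 1 \<and>
        V = X \<union> Y \<union> K \<and>
        E = {{x, y} | x y. x \<in> X \<and> y \<in> Y} \<union> {e. e \<subseteq> K \<and> card e = 2})"

end

theory Submission
  imports Defs
begin

text \<open>
  Let \<open>U\<close> maximise \<open>6 e(S) - |S|\<^sup>2 - |S| - 12 k |S|\<close>. Every vertex of \<open>U\<close> then has degree at least
  \<open>(|U| + 6 k) / 3\<close> in \<open>U\<close>, so two of any three vertices of \<open>U\<close> have \<open>2 k\<close> common neighbours, and
  two such ``linked'' vertices are joined by paths of all even lengths up to \<open>2 k\<close>. As there is no
  cycle of length \<open>2 k + 1\<close>, the ends of an edge are neither linked nor linked to a common vertex, which
  makes \<open>U\<close> bipartite; the edge count then shows that fewer than \<open>7 k\<close> vertices lie outside.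

  Consider ears: paths with distinct ends in \<open>U\<close> and interior outside \<open>U\<close>. If each of them has
  the parity prescribed by the 2-colouring, adding ears keeps this property, and a maximal result
  \<open>B\<close> is bipartite and has no ears. Everything outside \<open>B\<close> is then suspended at cut
  vertices, and each outside vertex has at most one neighbour in \<open>B\<close>, which gives
  \<open>e(G) \<le> \<lfloor>(n - w)\<^sup>2 / 4\<rfloor> + (w + 1 choose 2)\<close> for \<open>w = |V - B|\<close>. This bound decreases in
  \<open>w\<close> and equals the hypothesis at \<open>w = r - 1\<close>.

  A shortest ear of the wrong parity has at least \<open>2 k - 1\<close> interior vertices, of which all but
  the first and the last have at most one neighbour in \<open>U\<close>. This costs too many edges.
\<close>

section \<open>Neighbourhoods and edge sets relative to a vertex set\<close>

definition nbrs :: "'a set set \<Rightarrow> 'a set \<Rightarrow> 'a \<Rightarrow> 'a set" where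
  "nbrs E S v = {b \<in> S. {v, b} \<in> E}"

definition edges_in :: "'a set set \<Rightarrow> 'a set \<Rightarrow> 'a set set" where
  "edges_in E S = {e \<in> E. e \<subseteq> S}"

abbreviation adj :: "'a set set \<Rightarrow> 'a \<Rightarrow> 'a \<Rightarrow> bool" where
  "adj E x y \<equiv> {x, y} \<in> E"

section \<open>Counting edges\<close>

lemma graph_irrefl: "graph V E \<Longrightarrow> \<not> adj E x x"
  unfolding graph_def by fastforce

lemma graph_finite_edges: "graph V E \<Longrightarrow> finite E"
  unfolding graph_def by (meson Pow_iff finite_Pow_iff finite_subset subsetI)

lemma graph_edgeE:
  assumes "graph V E" "e \<in> E"
  obtains x y where "e = {x, y}" "x \<noteq> y" "x \<in> V" "y \<in> V"
  using assms unfolding graph_def by (metis card_2_iff insert_subset)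

lemma edges_inE:
  assumes "graph V E" "e \<in> edges_in E S"
  obtains x y where "e = {x, y}" "x \<noteq> y" "x \<in> S" "y \<in> S" "adj E x y"
proof -
  obtain x y where "e = {x, y}" "x \<noteq> y"
    using assms graph_edgeE[of V E e] unfolding edges_in_def by blast
  then show thesis using assms(2) by (intro that[of x y]) (auto simp: edges_in_def)
qed

lemma nbrs_subset: "nbrs E S v \<subseteq> S"
  by (auto simp: nbrs_def)

lemma finite_nbrs: "finite S \<Longrightarrow> finite (nbrs E S v)"
  by (simp add: nbrs_def)

lemma card_edges_in_insert:
  assumes "graph V E" "finite S" "v \<notin> S"
  shows "card (edges_in E (insert v S)) = card (edges_in E S) + card (nbrs E S v)"
proof -
  have eq: "edges_in E (insert v S) = edges_in E S \<union> (\<lambda>b. {v, b}) ` nbrs E S v"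
  proof (intro equalityI subsetI)
    fix e assume e: "e \<in> edges_in E (insert v S)"
    then obtain x y where "e = {x, y}" "x \<noteq> y"
      using edges_inE[OF assms(1)] by metis
    with e show "e \<in> edges_in E S \<union> (\<lambda>b. {v, b}) ` nbrs E S v"
      by (auto simp: edges_in_def nbrs_def insert_commute)
  qed (auto simp: edges_in_def nbrs_def)
  have "card ((\<lambda>b. {v, b}) ` nbrs E S v) = card (nbrs E S v)"
    by (rule card_image) (auto simp: inj_on_def doubleton_eq_iff)
  moreover have "edges_in E S \<inter> (\<lambda>b. {v, b}) ` nbrs E S v = {}"
    using assms(3) by (auto simp: edges_in_def)
  moreover have "finite (edges_in E S)"
    using graph_finite_edges[OF assms(1)] by (simp add: edges_in_def)
  ultimately show ?thesis
    using eq finite_nbrs[OF assms(2)] by (simp add: card_Un_disjoint)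
qed

lemma card_nbrs_Un:
  assumes "finite S" "finite T" "S \<inter> T = {}"
  shows "card (nbrs E (S \<union> T) v) = card (nbrs E S v) + card (nbrs E T v)"
proof -
  have "nbrs E (S \<union> T) v = nbrs E S v \<union> nbrs E T v" "nbrs E S v \<inter> nbrs E T v = {}"
    using assms(3) by (auto simp: nbrs_def)
  then show ?thesis using assms by (simp add: card_Un_disjoint finite_nbrs)
qed

text \<open>The last sum counts the crossing edges, each from its end in \<open>T\<close>. Adding
  the vertices of \<open>T\<close> one at a time reduces the claim to
  \<open>card_edges_in_insert\<close>.\<close>

lemma card_edges_in_Un:
  assumes "graph V E" "finite S" "finite T" "S \<inter> T = {}"
  shows "card (edges_in E (S \<union> T)) =
    card (edges_in E S) + card (edges_in E T) + (\<Sum>v\<in>T. card (nbrs E S v))"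
  using assms(3,4)
proof (induction T rule: finite_induct)
  case empty
  have "edges_in E {} = {}"
    using assms(1) by (auto simp: edges_in_def graph_def)
  then show ?case by simp
next
  case (insert v T)
  then show ?case
    using card_edges_in_insert[OF assms(1), of "S \<union> T" v]
      card_edges_in_insert[OF assms(1), of T v] card_nbrs_Un[of S T E v] assms(2)
    by auto
qed

lemma edges_in_subset_pairs:
  "graph V E \<Longrightarrow> edges_in E T \<subseteq> {e. e \<subseteq> T \<and> card e = 2}"
  by (auto simp: edges_in_def graph_def)

lemma finite_pairs: "finite T \<Longrightarrow> finite {e. e \<subseteq> T \<and> card e = 2}"
  by simp

lemma card_edges_in_le:
  assumes "graph V E" "finite T"
  shows "card (edges_in E T) \<le> card T choose 2"
  using card_mono[OF finite_pairs edges_in_subset_pairs] assms n_subsets[of T 2] by metis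

lemma card_edges_in_less:
  assumes "graph V E" "finite T" "a \<in> T" "b \<in> T" "a \<noteq> b" "\<not> adj E a b"
  shows "card (edges_in E T) < card T choose 2"
proof -
  have "edges_in E T \<noteq> {e. e \<subseteq> T \<and> card e = 2}"
  proof
    assume "edges_in E T = {e. e \<subseteq> T \<and> card e = 2}"
    moreover have "{a, b} \<in> {e. e \<subseteq> T \<and> card e = 2}" using assms(3-5) by simp
    ultimately show False using assms(6) by (auto simp: edges_in_def)
  qed
  then have "edges_in E T \<subset> {e. e \<subseteq> T \<and> card e = 2}"
    using edges_in_subset_pairs[OF assms(1)] by blast
  then show ?thesis
    using psubset_card_mono[OF finite_pairs[OF assms(2)]] n_subsets[OF assms(2), of 2] by simp
qed

lemma card_edges_between:
  assumes "X \<inter> Y = {}" "P \<subseteq> X \<times> Y"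
  shows "card ((\<lambda>(x, y). {x, y}) ` P) = card P"
proof (rule card_image, rule inj_onI)
  fix p q assume "p \<in> P" "q \<in> P" "(\<lambda>(x, y). {x, y}) p = (\<lambda>(x, y). {x, y}) q"
  moreover have "p \<in> X \<times> Y" "q \<in> X \<times> Y" using assms(2) calculation by auto
  ultimately show "p = q" using assms(1) by (auto simp: doubleton_eq_iff)
qed

text \<open>The edges inject into the pairs from \<open>X\<close> and \<open>Y\<close> that avoid
  the box of \<open>N1\<close> and \<open>N2\<close>. The saved product later pays for edges leaving
  the core; with empty boxes this is the usual bipartite bound.\<close>

lemma card_edges_bipartite_missing:
  assumes G: "graph V E" and fin: "finite X" "finite Y" and disj: "X \<inter> Y = {}"
    and ind: "\<And>x y. x \<in> X \<union> Y \<Longrightarrow> y \<in> X \<union> Y \<Longrightarrow> adj E x y \<Longrightarrow> x \<in> X \<longleftrightarrow> y \<in> Y"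
    and N: "N1 \<subseteq> X" "N2 \<subseteq> Y" and no: "\<And>x y. x \<in> N1 \<Longrightarrow> y \<in> N2 \<Longrightarrow> \<not> adj E x y"
  shows "card (edges_in E (X \<union> Y)) + card N1 * card N2 \<le> card X * card Y"
proof -
  let ?P = "X \<times> Y - N1 \<times> N2"
  have fP: "finite ?P" using fin by blast
  have sub: "edges_in E (X \<union> Y) \<subseteq> (\<lambda>(x, y). {x, y}) ` ?P"
  proof
    fix e assume e: "e \<in> edges_in E (X \<union> Y)"
    then obtain x y where xy: "e = {x, y}" "x \<noteq> y"
      using edges_inE[OF G] by metis
    then have "x \<in> X \<union> Y" "y \<in> X \<union> Y" "adj E x y" "adj E y x"
      using e by (auto simp: edges_in_def insert_commute)
    with ind disj no xy have "(x, y) \<in> ?P \<or> (y, x) \<in> ?P"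
      by (smt (verit) DiffI Diff_iff Int_iff Un_iff empty_iff mem_Sigma_iff)
    then show "e \<in> (\<lambda>(x, y). {x, y}) ` ?P"
      using xy by (force simp: insert_commute)
  qed
  have "card (edges_in E (X \<union> Y)) \<le> card ?P"
    using card_mono[OF finite_imageI[OF fP] sub] card_edges_between[of X Y ?P] disj by auto
  moreover have "card ?P = card X * card Y - card N1 * card N2"
    using N fin by (subst card_Diff_subset) (auto simp: card_cartesian_product intro: finite_subset)
  moreover have "card N1 * card N2 \<le> card X * card Y"
    using N fin by (intro mult_le_mono card_mono)
  ultimately show ?thesis by linarith
qed

lemma mult_le_square_div4: "(a::nat) * b \<le> (a + b)\<^sup>2 div 4"
proof -
  have "4 * (a * b) \<le> (a + b)\<^sup>2"
  proof (cases "a \<le> b")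
    case True
    then obtain d where "b = a + d" using le_Suc_ex by blast
    then show ?thesis by (simp add: power2_eq_square algebra_simps)
  next
    case False
    then obtain d where "a = b + d" using le_Suc_ex nat_le_linear by blast
    then show ?thesis by (simp add: power2_eq_square algebra_simps)
  qed
  then show ?thesis by linarith
qed

section \<open>Linked pairs in a subgraph of large minimum degree\<close>

text \<open>A path with a closing edge is easier to build from pieces than the cyclic indexing of
  \<open>has_cycle\<close>.\<close>

lemma has_cycleI:
  assumes "length vs = L" "L \<ge> 1" "distinct vs" "set vs \<subseteq> V" "successively (adj E) vs"
    "adj E (last vs) (hd vs)"
  shows "has_cycle V E L"
  unfolding has_cycle_def
proof (intro exI[of _ vs] conjI allI impI)
  fix i assume i: "i < L"
  show "adj E (vs ! i) (vs ! ((i + 1) mod L))"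
  proof (cases "i + 1 = L")
    case True
    then show ?thesis
      using assms by (metis One_nat_def add_diff_cancel_right' hd_conv_nth last_conv_nth
          list.size(3) mod_self not_one_le_zero)
  next
    case False
    then show ?thesis using i assms(1,5) by (simp add: successively_conv_nth)
  qed
qed (use assms in auto)

locale odd_cycle_free =
  fixes V :: "'a set" and E :: "'a set set" and k :: nat
  assumes G: "graph V E" and no_cycle: "\<not> has_cycle V E (2 * k + 1)" and k: "k \<ge> 2"
begin

lemma finV: "finite V"
  using G by (simp add: graph_def)

lemma adj_commute: "adj E x y = adj E y x"
  by (simp add: insert_commute)

lemma adj_neq: "adj E x y \<Longrightarrow> x \<noteq> y"
  using graph_irrefl[OF G] by auto

lemma successively_rev_adj: "successively (adj E) (rev xs) = successively (adj E) xs"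
  by (simp add: successively_rev adj_commute)

lemma no_odd_cycle:
  assumes "length vs = 2 * k + 1" "distinct vs" "set vs \<subseteq> V" "successively (adj E) vs"
    "adj E (last vs) (hd vs)"
  shows False
  using has_cycleI[of vs "2 * k + 1" V E] no_cycle assms by simp

end

locale core = odd_cycle_free V E k for V :: "'a set" and E k +
  fixes U :: "'a set"
  assumes UV: "U \<subseteq> V" and deg_core: "\<And>v. v \<in> U \<Longrightarrow> card U + 6 * k \<le> 3 * card (nbrs E U v)"
begin

abbreviation N :: "'a \<Rightarrow> 'a set" where
  "N \<equiv> nbrs E U"

text \<open>The value 2k lets a common neighbour be chosen outside any set of fewer than 2k
  vertices, which is how paths are threaded through linked vertices.\<close>

definition linked :: "'a \<Rightarrow> 'a \<Rightarrow> bool" where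
  "linked u v \<longleftrightarrow> u \<noteq> v \<and> 2 * k \<le> card (N u \<inter> N v)"

lemma finU: "finite U"
  using UV finV finite_subset by blast

lemma finN: "finite (N v)"
  by (rule finite_nbrs[OF finU])

lemma linked_commute: "linked u v = linked v u"
  by (auto simp: linked_def Int_commute)

text \<open>Three degrees add up to at least |U| + 6k while the union has at most |U| vertices, so
  the three pairwise intersections have at least 6k vertices in total.\<close>

lemma linked_among_three:
  assumes "x \<in> U" "y \<in> U" "z \<in> U" "x \<noteq> y" "x \<noteq> z" "y \<noteq> z"
  shows "linked x y \<or> linked x z \<or> linked y z"
proof (rule ccontr)
  assume "\<not> ?thesis"
  then have small: "card (N x \<inter> N y) < 2 * k" "card (N x \<inter> N z) < 2 * k" "card (N y \<inter> N z) < 2 * k"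
    using assms by (auto simp: linked_def)
  have 1: "card (N x) + card (N y) = card (N x \<union> N y) + card (N x \<inter> N y)"
    using finN by (rule card_Un_Int) (rule finN)
  have 2: "card (N x \<union> N y) + card (N z) = card (N x \<union> N y \<union> N z) + card ((N x \<union> N y) \<inter> N z)"
    using finN by (intro card_Un_Int) auto
  have 3: "card ((N x \<union> N y) \<inter> N z) \<le> card (N x \<inter> N z) + card (N y \<inter> N z)"
    by (simp add: Int_Un_distrib2 card_Un_le)
  have 4: "card (N x \<union> N y \<union> N z) \<le> card U"
    using finU nbrs_subset by (intro card_mono) (auto simp: nbrs_def)
  show False
    using 1 2 3 4 small deg_core[OF assms(1)] deg_core[OF assms(2)] deg_core[OF assms(3)] by linarith
qed

text \<open>If a path cannot be extended at its head, then the vertices outside it are pairwise linked,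
  as no three vertices are pairwise unlinked.\<close>

lemma linked_path_exists:
  assumes "C \<subseteq> U" "j \<ge> 1" "2 * j \<le> card C + 1"
  shows "\<exists>cs. length cs = j \<and> distinct cs \<and> set cs \<subseteq> C \<and> successively linked cs"
  using assms(2,3)
proof (induction j rule: dec_induct)
  case base
  then obtain c where "c \<in> C" by fastforce
  then show ?case by (intro exI[of _ "[c]"]) auto
next
  case (step j)
  then obtain cs where cs: "length cs = j" "distinct cs" "set cs \<subseteq> C" "successively linked cs"
    by auto
  then obtain c cs' where ccs: "cs = c # cs'" using step by (cases cs) auto
  let ?O = "C - set cs"
  have finC: "finite C" using assms(1) finU finite_subset by blast
  \<comment> \<open>From 2(j + 1) <= |C| + 1, removing j vertices leaves at least j + 1: enough to
    build the longer path from scratch if the old one cannot be extended.\<close>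
  have cO: "Suc j \<le> card ?O"
    using cs step finC card_Diff_subset[of "set cs" C] distinct_card[of cs] by auto
  show ?case
  proof (cases "\<exists>d\<in>?O. linked d c")
    case True
    then obtain d where "d \<in> ?O" "linked d c" by blast
    then show ?thesis using cs ccs by (intro exI[of _ "d # cs"]) auto
  next
    case False
    have cl: "linked x y" if "x \<in> ?O" "y \<in> ?O" "x \<noteq> y" for x y
      using linked_among_three[of x y c] that False cs ccs assms(1) by auto
    obtain D where D: "D \<subseteq> ?O" "card D = Suc j" "finite D"
      using cO obtain_subset_with_card_n by blast
    obtain ds where ds: "set ds = D" "distinct ds"
      using finite_distinct_list[OF D(3)] by blast
    have "successively linked ds"
      unfolding successively_conv_nth
      using ds D(1) cl by (metis Suc_lessD lessI nat_neq_iff nth_eq_iff_index_eq nth_mem subsetD)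
    then show ?thesis
      using ds D distinct_card[of ds] by (intro exI[of _ ds]) auto
  qed
qed

text \<open>A fresh common neighbour is inserted between consecutive vertices of the linked path. In
  the recursion \<open>F\<close> absorbs the head, so that the rest of the path avoids it.\<close>

lemma linked_path_interleave:
  assumes "length cs = j" "j \<ge> 1" "distinct cs" "set cs \<subseteq> U" "successively linked cs"
    "finite F" "F \<inter> set cs = {}" "card F + 2 * j \<le> 2 * k + 2"
  shows "\<exists>ps. length ps = 2 * j - 1 \<and> distinct ps \<and> set ps \<subseteq> U - F \<and> successively (adj E) ps
    \<and> hd ps = hd cs \<and> last ps = last cs"
  using assms
proof (induction cs arbitrary: j F)
  case Nil
  then show ?case by simp
next
  case (Cons c cs)
  show ?case
  proof (cases cs)
    case Nil
    then show ?thesis using Cons.prems by (intro exI[of _ "[c]"]) auto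
  next
    case (Cons d ds)
    have j: "j = Suc (length cs)" "length cs \<ge> 1" using Cons Cons.prems by auto
    have cF: "card (insert c F) + 2 * length cs \<le> 2 * k + 2"
      using Cons.prems(7,8) j card_insert_if[OF Cons.prems(6), of c] by auto
    obtain ps where ps: "length ps = 2 * length cs - 1" "distinct ps" "set ps \<subseteq> U - insert c F"
      "successively (adj E) ps" "hd ps = hd cs" "last ps = last cs"
      using Cons.IH[of "length cs" "insert c F"] Cons.prems j cF Cons by auto
    have "linked c d" using Cons Cons.prems by auto
    then have "2 * k \<le> card (N c \<inter> N d)" by (simp add: linked_def)
    \<comment> \<open>The count is |F| + 2(j - 1) - 1 <= 2k - 1, so one of the 2k common neighbours
      of \<open>c\<close> and \<open>d\<close> is still free.\<close>
    moreover have "card (F \<union> set ps) < 2 * k"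
      using card_Un_le[of F "set ps"] distinct_card[OF ps(2)] ps(1) j Cons.prems(8) by linarith
    ultimately have "\<not> N c \<inter> N d \<subseteq> F \<union> set ps"
      using card_mono[of "F \<union> set ps" "N c \<inter> N d"] Cons.prems(6) by auto
    then obtain h where h: "h \<in> N c" "h \<in> N d" "h \<notin> F" "h \<notin> set ps" by auto
    have hc: "h \<noteq> c" "adj E c h" "adj E h d" "h \<in> U"
      using h adj_neq by (auto simp: nbrs_def adj_commute)
    have ne: "ps \<noteq> []" using ps(1) j by auto
    have "successively (adj E) (c # h # ps)"
      using ps hc Cons ne by (cases ps) auto
    then show ?thesis
      using ps hc h Cons Cons.prems j ne by (intro exI[of _ "c # h # ps"]) auto
  qed
qed

text \<open>The linked path is taken among the common neighbours of \<open>u\<close> and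
  \<open>v\<close>. After interleaving, its two ends are still such common neighbours, so
  \<open>u\<close> and \<open>v\<close> can be attached, giving a path with 2j edges.\<close>

lemma even_path:
  assumes "linked u v" "u \<in> U" "v \<in> U" "finite F" "u \<notin> F" "v \<notin> F" "j \<ge> 1"
    "card F + 2 * j \<le> 2 * k"
  shows "\<exists>ps. length ps = 2 * j - 1 \<and> distinct (u # ps @ [v]) \<and> set ps \<subseteq> U - F
    \<and> successively (adj E) (u # ps @ [v])"
proof -
  let ?C = "N u \<inter> N v - F"
  have "2 * k \<le> card (N u \<inter> N v)" using assms(1) by (simp add: linked_def)
  then have "2 * j \<le> card ?C + 1"
    using diff_card_le_card_Diff[OF assms(4), of "N u \<inter> N v"] assms(8) by linarith
  then obtain cs where cs: "length cs = j" "distinct cs" "set cs \<subseteq> ?C" "successively linked cs"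
    using linked_path_exists[of ?C j] assms(7) by (auto simp: nbrs_def)
  have nuv: "u \<notin> N u" "v \<notin> N v" using graph_irrefl[OF G] by (auto simp: nbrs_def)
  \<comment> \<open>The ends \<open>u\<close> and \<open>v\<close> join the forbidden set; they
    account for the 2 in the bound 2k + 2 of \<open>linked_path_interleave\<close>.\<close>
  have uv: "card (insert u (insert v F)) + 2 * j \<le> 2 * k + 2"
    using assms(4,8) card_insert_le_m1 by (simp add: card_insert_if)
  have "set cs \<subseteq> U" "insert u (insert v F) \<inter> set cs = {}"
    using cs(3) nuv by (auto simp: nbrs_def)
  then obtain ps where ps: "length ps = 2 * j - 1" "distinct ps"
    "set ps \<subseteq> U - insert u (insert v F)" "successively (adj E) ps" "hd ps = hd cs" "last ps = last cs"
    using linked_path_interleave[of cs j "insert u (insert v F)"] cs assms(4,7) uv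
    by (meson finite_insert)
  have ne: "ps \<noteq> []" "cs \<noteq> []" using ps(1) cs(1) assms(7) by auto
  then have "hd cs \<in> N u" "last cs \<in> N v"
    using cs(3) hd_in_set[of cs] last_in_set[of cs] by blast+
  then have "adj E u (hd ps)" "adj E (last ps) v"
    using ps by (auto simp: nbrs_def adj_commute)
  then have "successively (adj E) (u # ps @ [v])"
    using ps ne by (simp add: successively_Cons successively_append_iff)
  then show ?thesis using ps assms(1) by (intro exI[of _ ps]) (auto simp: linked_def)
qed

text \<open>An edge between linked vertices would close an even path with 2k edges to a forbidden
  cycle.\<close>

lemma linked_not_adj:
  assumes "linked u v" "u \<in> U" "v \<in> U"
  shows "\<not> adj E u v"
proof
  assume a: "adj E u v"
  obtain ps where ps: "length ps = 2 * k - 1" "distinct (u # ps @ [v])" "set ps \<subseteq> U - {}"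
    "successively (adj E) (u # ps @ [v])"
    using even_path[OF assms, of "{}" k] k by auto
  show False
    using no_odd_cycle[of "u # ps @ [v]"] ps UV assms a k adj_commute by auto
qed

text \<open>The forbidden cycle runs from \<open>u\<close> over a common neighbour \<open>c\<close>
  to \<open>w\<close>, then along an even path with 2(k - 1) edges to \<open>v\<close>, and back
  over the edge \<open>uv\<close>.\<close>

lemma adj_no_common_linked:
  assumes "adj E u v" "linked u w" "linked w v" "u \<in> U" "v \<in> U" "w \<in> U"
  shows False
proof -
  have "\<not> N u \<inter> N w \<subseteq> {v}"
    using assms(2) k card_mono[of "{v}" "N u \<inter> N w"] by (auto simp: linked_def)
  then obtain c where c: "c \<in> U" "adj E u c" "adj E c w" "c \<noteq> v"
    by (auto simp: nbrs_def adj_commute)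
  have neq: "c \<noteq> u" "c \<noteq> w" "u \<noteq> w" "u \<noteq> v" "w \<noteq> v"
    using c assms adj_neq by (auto simp: linked_def)
  have "1 \<le> k - 1" "card {u, c} + 2 * (k - 1) \<le> 2 * k" "w \<notin> {u, c}" "v \<notin> {u, c}"
    using k neq c(4) by auto
  then obtain ps where ps: "length ps = 2 * (k - 1) - 1" "distinct (w # ps @ [v])"
    "set ps \<subseteq> U - {u, c}" "successively (adj E) (w # ps @ [v])"
    using even_path[OF assms(3,6,5), of "{u, c}" "k - 1"] by blast
  have "length (u # c # w # ps @ [v]) = 2 * k + 1" using ps(1) k by auto
  moreover have "distinct (u # c # w # ps @ [v])" "set (u # c # w # ps @ [v]) \<subseteq> V"
    "successively (adj E) (u # c # w # ps @ [v])"
    using ps UV assms c neq by auto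
  ultimately show False
    using no_odd_cycle[of "u # c # w # ps @ [v]"] assms(1) adj_commute by simp
qed

text \<open>Fix an edge \<open>uv\<close> and colour by being \<open>u\<close> or linked to
  \<open>u\<close>. Adjacent vertices \<open>x\<close>, \<open>y\<close> of equal colour are not
  linked. If both lie in the class of \<open>u\<close>, neither is linked to \<open>v\<close>, as
  the ends of \<open>uv\<close> would share a linked vertex; otherwise neither is linked to
  \<open>u\<close>. Either way three vertices are pairwise unlinked.\<close>

lemma core_bipartite:
  "\<exists>col. \<forall>x\<in>U. \<forall>y\<in>U. adj E x y \<longrightarrow> col x \<noteq> (col y :: bool)"
proof (cases "\<exists>u\<in>U. \<exists>v\<in>U. adj E u v")
  case True
  then obtain u v where uv: "u \<in> U" "v \<in> U" "adj E u v" by blast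
  then have nl: "\<not> linked u v" "u \<noteq> v" using linked_not_adj adj_neq by auto
  let ?c = "\<lambda>x. x = u \<or> linked u x"
  have "?c x \<noteq> ?c y" if xy: "x \<in> U" "y \<in> U" "adj E x y" for x y
  proof
    assume same: "?c x = ?c y"
    have neq: "x \<noteq> y" and nxy: "\<not> linked x y"
      using xy linked_not_adj adj_neq by auto
    show False
    proof (cases "?c x")
      case True
      have "\<not> linked z v \<and> z \<noteq> v" if "?c z" "z \<in> U" for z
        using that nl adj_no_common_linked[OF uv(3), of z] uv by auto
      then show False
        using linked_among_three[of x y v] xy uv True same neq nxy by blast
    next
      case False
      then show False
        using linked_among_three[of x y u] xy uv same neq nxy linked_commute by blast
    qed
  qed
  then show ?thesis by (intro exI[of _ ?c]) blast
qed auto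

end


section \<open>Ears\<close>

lemma successively_append_Cons:
  "successively P (xs @ x # ys) \<longleftrightarrow> successively P (xs @ [x]) \<and> successively P (x # ys)"
  by (auto simp: successively_append_iff)

context odd_cycle_free
begin

text \<open>An empty \<open>ms\<close> is allowed, so every edge inside \<open>B\<close> is an
  ear.\<close>

definition ear :: "'a set \<Rightarrow> 'a \<Rightarrow> 'a list \<Rightarrow> 'a \<Rightarrow> bool" where
  "ear B p ms q \<longleftrightarrow> p \<in> B \<and> q \<in> B \<and> p \<noteq> q \<and> set ms \<subseteq> V - B \<and> distinct ms
    \<and> successively (adj E) (p # ms @ [q])"

text \<open>The ear has \<open>length ms + 1\<close> edges, so this says that \<open>c\<close>
  extends to alternating colours along it. For empty \<open>ms\<close> it says that the edge is
  properly coloured.\<close>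

definition good :: "('a \<Rightarrow> bool) \<Rightarrow> 'a \<Rightarrow> 'a list \<Rightarrow> 'a \<Rightarrow> bool" where
  "good c p ms q \<longleftrightarrow> (c p = c q \<longleftrightarrow> odd (length ms))"

definition ears_good :: "'a set \<Rightarrow> ('a \<Rightarrow> bool) \<Rightarrow> bool" where
  "ears_good B c \<longleftrightarrow> (\<forall>p ms q. ear B p ms q \<longrightarrow> good c p ms q)"

lemma successively_rev_ends:
  "successively (adj E) (q # rev ms @ [p]) = successively (adj E) (p # ms @ [q])"
  using successively_rev_adj[of "p # ms @ [q]"] by simp

lemma ear_rev: "ear B q (rev ms) p = ear B p ms q"
  unfolding ear_def successively_rev_ends by auto

lemma good_rev: "good c q (rev ms) p = good c p ms q"
  by (auto simp: good_def)

lemma ears_good_proper: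
  "ears_good B c \<Longrightarrow> x \<in> B \<Longrightarrow> y \<in> B \<Longrightarrow> adj E x y \<Longrightarrow> c x \<noteq> c y"
  unfolding ears_good_def using adj_neq[of x y] by (force simp: ear_def good_def dest: spec[of _ "[]"])

text \<open>Every ear of \<open>B \<union> set ms\<close> extends along \<open>ms\<close> to an ear of \<open>B\<close>.\<close>

lemma ears_good_Un:
  assumes good: "ears_good B c" and e: "ear B p ms q"
  shows "\<exists>c'. ears_good (B \<union> set ms) c'"
proof -
  \<comment> \<open>Colours alternate along \<open>ms\<close>, starting with the opposite of
    \<open>c p\<close>.\<close>
  define c' where
    "c' x = (if x \<in> set ms then c p = odd (length (takeWhile (\<lambda>y. y \<noteq> x) ms)) else c x)" for x
  have gB: "good c u ns v" if "ear B u ns v" for u ns v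
    using good that by (auto simp: ears_good_def)
  have pq: "p \<in> B" "q \<in> B" "p \<noteq> q" "set ms \<inter> B = {}" "set ms \<subseteq> V" "distinct ms"
    "successively (adj E) (p # ms @ [q])"
    using e by (auto simp: ear_def)
  have c'_ms: "c' x = (c p = odd (length A))" if "ms = A @ x # C" for A x C
  proof -
    have "takeWhile (\<lambda>y. y \<noteq> x) ms = A"
      using that pq(6) by (auto simp: takeWhile_append)
    then show ?thesis using that by (simp add: c'_def)
  qed
  have c'_B: "c' x = c x" if "x \<in> B" for x
    using that pq(4) by (auto simp: c'_def)
  have one: "good c' x ns y" if xe: "ear (B \<union> set ms) x ns y" and xy: "x \<in> set ms" "y \<in> B" for x ns y
  proof -
    obtain A C where ms: "ms = A @ x # C" using xy(1) split_list by fast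
    have s1: "successively (adj E) (p # A @ [x])" "successively (adj E) (x # C @ [q])"
      using pq(7) successively_append_Cons[of "adj E" "p # A" x "C @ [q]"] ms by auto
    have ns: "set ns \<subseteq> V - (B \<union> set ms)" "distinct ns" "successively (adj E) (x # ns @ [y])"
      using xe by (auto simp: ear_def)
    \<comment> \<open>If \<open>y\<close> differs from \<open>p\<close>, go from \<open>p\<close>
      along \<open>ms\<close> to \<open>x\<close> and on through \<open>ns\<close> to
      \<open>y\<close>. If \<open>y = p\<close> this would return to its start, so go back along
      \<open>ns\<close> from \<open>p\<close> to \<open>x\<close> and on to \<open>q\<close>, and
      compare with the original ear.\<close>
    show ?thesis
    proof (cases "y = p")
      case False
      have "successively (adj E) (p # (A @ x # ns) @ [y])"
        using successively_append_Cons[of "adj E" "p # A" x "ns @ [y]"] s1 ns by simp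
      then have "ear B p (A @ x # ns) y"
        using False pq ms ns xy by (auto simp: ear_def)
      from gB[OF this] show ?thesis
        using c'_ms[OF ms] c'_B[OF xy(2)] by (auto simp: good_def)
    next
      case True
      have "successively (adj E) (p # (rev ns @ x # C) @ [q])"
        using successively_append_Cons[of "adj E" "p # rev ns" x "C @ [q]"] s1
          successively_rev_ends[of y ns x] ns True by simp
      then have "ear B p (rev ns @ x # C) q"
        using pq ms ns xy by (auto simp: ear_def)
      from gB[OF this] gB[OF e] show ?thesis
        using c'_ms[OF ms] c'_B[OF xy(2)] True ms by (auto simp: good_def)
    qed
  qed
  \<comment> \<open>Replacing the segment \<open>M\<close> of \<open>ms\<close> by \<open>ns\<close>
    gives another ear from \<open>p\<close> to \<open>q\<close>. Both are good, so \<open>M\<close>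
    and \<open>ns\<close> have lengths of equal parity.\<close>
  have two: "good c' x ns y"
    if xe: "ear (B \<union> set ms) x ns y" and ms: "ms = A @ x # M @ y # C" for x ns y A M C
  proof -
    have s1: "successively (adj E) (p # A @ [x])" "successively (adj E) (y # C @ [q])"
      using pq(7) successively_append_Cons[of "adj E" "p # A" x "M @ y # C @ [q]"]
        successively_append_Cons[of "adj E" "x # M" y "C @ [q]"] ms by auto
    have ns: "set ns \<subseteq> V - (B \<union> set ms)" "distinct ns" "successively (adj E) (x # ns @ [y])"
      using xe by (auto simp: ear_def)
    have "successively (adj E) (p # (A @ x # ns @ y # C) @ [q])"
      using successively_append_Cons[of "adj E" "p # A" x "ns @ y # C @ [q]"]
        successively_append_Cons[of "adj E" "x # ns" y "C @ [q]"] s1 ns by simp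
    then have "ear B p (A @ x # ns @ y # C) q"
      using pq ms ns by (auto simp: ear_def)
    from gB[OF this] gB[OF e] show ?thesis
      using c'_ms[OF ms] c'_ms[of "A @ x # M" y C] ms by (auto simp: good_def)
  qed
  have "good c' x ns y" if xe: "ear (B \<union> set ms) x ns y" for x ns y
  proof -
    have xy: "x \<in> B \<union> set ms" "y \<in> B \<union> set ms" "x \<noteq> y" using xe by (auto simp: ear_def)
    have re: "ear (B \<union> set ms) y (rev ns) x" using xe by (simp add: ear_rev)
    consider "x \<in> B" "y \<in> B" | "x \<in> set ms" "y \<in> B" | "x \<in> B" "y \<in> set ms"
      | "x \<in> set ms" "y \<in> set ms" using xy by blast
    then show ?thesis
    proof cases
      case 1
      then have "ear B x ns y" using xe by (auto simp: ear_def)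
      from gB[OF this] show ?thesis using 1 c'_B by (simp add: good_def)
    next
      case 2
      then show ?thesis using one xe by blast
    next
      case 3
      then show ?thesis using one[OF re] good_rev by blast
    next
      case 4
      then obtain A C where ms: "ms = A @ x # C" using split_list by fast
      then have "y \<in> set A \<or> y \<in> set C" using 4 xy by auto
      then show ?thesis
      proof
        assume "y \<in> set C"
        then obtain M D where "C = M @ y # D" using split_list by fast
        then show ?thesis using two[OF xe] ms by simp
      next
        assume "y \<in> set A"
        then obtain M D where "A = D @ y # M" using split_list by fast
        then show ?thesis using two[OF re] ms good_rev by simp
      qed
    qed
  qed
  then show ?thesis by (auto simp: ears_good_def)
qed

text \<open>Absorbing a nonempty ear shrinks the outside, so the process ends.\<close>

lemma ear_closure:
  assumes "ears_good U c" "U \<subseteq> V"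
  shows "\<exists>B c'. U \<subseteq> B \<and> B \<subseteq> V \<and> ears_good B c' \<and> (\<forall>p ms q. ear B p ms q \<longrightarrow> ms = [])"
  using assms
proof (induction "card (V - U)" arbitrary: U c rule: less_induct)
  case less
  show ?case
  proof (cases "\<exists>p ms q. ear U p ms q \<and> ms \<noteq> []")
    case True
    then obtain p ms q where e: "ear U p ms q" "ms \<noteq> []" by blast
    then obtain c' where c': "ears_good (U \<union> set ms) c'"
      using ears_good_Un less.prems by blast
    have ms: "set ms \<subseteq> V - U" "hd ms \<in> set ms" using e by (auto simp: ear_def)
    then have "hd ms \<in> V - U" by blast
    then have "V - (U \<union> set ms) \<subset> V - U" using ms(2) by blast
    then have "card (V - (U \<union> set ms)) < card (V - U)"
      using finV by (intro psubset_card_mono) auto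
    moreover have "U \<union> set ms \<subseteq> V" using ms(1) less.prems(2) by blast
    ultimately obtain B c'' where "U \<union> set ms \<subseteq> B" "B \<subseteq> V" "ears_good B c''"
      "\<forall>p ms q. ear B p ms q \<longrightarrow> ms = []"
      using less.hyps[OF _ c'] by blast
    then show ?thesis by (intro exI[of _ B] exI[of _ c'']) simp
  qed (use less.prems in blast)
qed

end

section \<open>The graph outside an ear-closed bipartite subgraph\<close>

text \<open>This is the edge count of a balanced complete bipartite graph on n - w vertices with a
  complete graph on w + 1 vertices suspended; w = r - 1 gives the bound of the theorem.\<close>

definition edge_bound :: "nat \<Rightarrow> nat \<Rightarrow> nat" where
  "edge_bound n w = (n - w)\<^sup>2 div 4 + (w + 1 choose 2)"

lemma choose_2_Suc: "Suc w choose 2 = w + (w choose 2)"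
  by (simp add: numeral_2_eq_2)

text \<open>Raising w by one loses about (n - w) / 2 in the quadratic term and gains w + 1 in the
  binomial.\<close>

lemma edge_bound_Suc:
  assumes "3 * w + 5 \<le> n"
  shows "edge_bound n (Suc w) < edge_bound n w"
proof -
  define m where "m = n - Suc w"
  have m: "n - w = Suc m" "2 * w + 4 \<le> m" using assms by (auto simp: m_def)
  have "4 * (m\<^sup>2 div 4) \<le> m\<^sup>2" by simp
  moreover have "(Suc m)\<^sup>2 = m\<^sup>2 + 2 * m + 1" by (simp add: power2_eq_square)
  ultimately have "m\<^sup>2 div 4 + (w + 1) < (Suc m)\<^sup>2 div 4" using m(2) by linarith
  then show ?thesis
    using m(1) choose_2_Suc[of "Suc w"] by (simp add: edge_bound_def m_def)
qed

lemma edge_bound_less: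
  assumes "w < w'" "3 * w' + 2 \<le> n"
  shows "edge_bound n w' < edge_bound n w"
  using assms
proof (induction w')
  case (Suc w')
  have "edge_bound n (Suc w') < edge_bound n w'" using Suc.prems by (intro edge_bound_Suc) simp
  then show ?case using Suc by (cases "w = w'") auto
qed simp

text \<open>If the factors differ by d, the floor exceeds the product by the floor of d^2 / 4, so d
  is at most 1.\<close>

lemma balanced_factors:
  fixes a b :: nat
  assumes "(a + b)\<^sup>2 div 4 \<le> a * b"
  shows "a = (a + b) div 2 \<or> b = (a + b) div 2"
proof -
  have *: "a = (a + (a + d)) div 2" if "(a + (a + d))\<^sup>2 div 4 \<le> a * (a + d)" for a d :: nat
  proof -
    have "(a + (a + d))\<^sup>2 = d\<^sup>2 + (a * (a + d)) * 4" by (simp add: power2_eq_square algebra_simps)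
    then have "(a + (a + d))\<^sup>2 div 4 = d\<^sup>2 div 4 + a * (a + d)"
      by (metis div_mult_self1 add.commute zero_neq_numeral)
    then have "d\<^sup>2 div 4 = 0" using that by simp
    then have "d\<^sup>2 < 2\<^sup>2" by simp
    then have "d < 2" using power_less_imp_less_base by blast
    then show ?thesis by auto
  qed
  show ?thesis
  proof (cases "a \<le> b")
    case True
    then obtain d where "b = a + d" using le_Suc_ex by blast
    then show ?thesis using * assms by blast
  next
    case False
    then obtain d where "a = b + d" using le_Suc_ex nat_le_linear by blast
    then show ?thesis using *[of b d] assms by (simp add: ac_simps)
  qed
qed

lemma choose_2_add: "s + d \<le> w \<Longrightarrow> (s + d) choose 2 \<le> (s choose 2) + d * w"
proof (induction d)
  case (Suc d)
  then show ?case using choose_2_Suc[of "s + d"] by simp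
qed simp

text \<open>Used to let d further vertices of a balanced bipartite graph, worth about u d / 2 edges,
  pay for t edges counted elsewhere.\<close>

lemma square_div4_add:
  fixes u d t :: nat
  assumes "2 * t + 2 \<le> u * d"
  shows "u\<^sup>2 div 4 + t < (u + d)\<^sup>2 div 4"
proof -
  have "(u + d)\<^sup>2 = u\<^sup>2 + 2 * (u * d) + d\<^sup>2" by (simp add: power2_eq_square algebra_simps)
  moreover have "4 * (u\<^sup>2 div 4) \<le> u\<^sup>2" by simp
  ultimately show ?thesis using assms by linarith
qed

lemma square_div4_add_le:
  fixes u d t :: nat
  assumes "2 * t \<le> u * d"
  shows "u\<^sup>2 div 4 + t \<le> (u + d)\<^sup>2 div 4"
proof -
  have "(u + d)\<^sup>2 = u\<^sup>2 + 2 * (u * d) + d\<^sup>2" by (simp add: power2_eq_square algebra_simps)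
  moreover have "4 * (u\<^sup>2 div 4) \<le> u\<^sup>2" by simp
  ultimately show ?thesis using assms by linarith
qed

section \<open>Attachment vertices and the two possible structures\<close>

context odd_cycle_free
begin

definition outside_step :: "'a set \<Rightarrow> ('a \<times> 'a) set" where
  "outside_step B = {(x, y). x \<in> V - B \<and> y \<in> V - B \<and> adj E x y}"

lemma outside_path:
  assumes "(x, y) \<in> (outside_step B)\<^sup>*" "y \<in> V - B"
  shows "\<exists>ms. ms \<noteq> [] \<and> hd ms = x \<and> last ms = y \<and> distinct ms \<and> set ms \<subseteq> V - B
    \<and> successively (adj E) ms"
  using assms(1)
proof (induction rule: converse_rtrancl_induct)
  case base
  then show ?case using assms(2) by (intro exI[of _ "[y]"]) auto
next
  case (step x z)
  then obtain ms where ms: "ms \<noteq> []" "hd ms = z" "last ms = y" "distinct ms" "set ms \<subseteq> V - B"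
    "successively (adj E) ms" by blast
  show ?case
  proof (cases "x \<in> set ms")
    case True
    then obtain A C where "ms = A @ x # C" using split_list by fast
    then show ?thesis using ms by (intro exI[of _ "x # C"]) (auto simp: successively_append_iff)
  next
    case False
    then show ?thesis using ms step(1)
      by (intro exI[of _ "x # ms"]) (auto simp: outside_step_def successively_Cons)
  qed
qed

lemma sym_outside_step: "sym (outside_step B)"
  by (auto simp: outside_step_def sym_def adj_commute)

text \<open>If a component of the outside had two neighbours in \<open>B\<close>, a path through it
  would be an ear with nonempty interior. Hence each component sees at most one vertex of
  \<open>B\<close>.\<close>

lemma attachment_map:
  assumes noear: "\<forall>p ms q. ear B p ms q \<longrightarrow> ms = []" and "B \<noteq> {}"
  obtains att where "\<And>w. att w \<in> B"
    "\<And>w b. w \<in> V - B \<Longrightarrow> b \<in> B \<Longrightarrow> adj E w b \<Longrightarrow> att w = b"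
    "\<And>w w'. w \<in> V - B \<Longrightarrow> w' \<in> V - B \<Longrightarrow> adj E w w' \<Longrightarrow> att w = att w'"
proof -
  define R where "R w b \<longleftrightarrow> b \<in> B \<and> (\<exists>y \<in> V - B. (w, y) \<in> (outside_step B)\<^sup>* \<and> adj E y b)" for w b
  obtain b0 where b0: "b0 \<in> B" using assms(2) by blast
  \<comment> \<open>Components without a neighbour in \<open>B\<close> are assigned to the arbitrary
    vertex \<open>b0\<close>.\<close>
  define att where "att w = (if Ex (R w) then SOME b. R w b else b0)" for w
  have uniq: "b = b'" if R: "R w b" "R w b'" for w b b'
  proof (rule ccontr)
    assume ne: "b \<noteq> b'"
    obtain y y' where y: "b \<in> B" "y \<in> V - B" "(w, y) \<in> (outside_step B)\<^sup>*" "adj E y b"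
      and y': "b' \<in> B" "y' \<in> V - B" "(w, y') \<in> (outside_step B)\<^sup>*" "adj E y' b'"
      using R unfolding R_def by blast
    have "(y, y') \<in> (outside_step B)\<^sup>*"
      using y(3) y'(3) sym_rtrancl[OF sym_outside_step] by (meson rtrancl_trans symD)
    then obtain ms where ms: "ms \<noteq> []" "hd ms = y" "last ms = y'" "distinct ms" "set ms \<subseteq> V - B"
      "successively (adj E) ms" using outside_path y'(2) by blast
    have "ear B b ms b'"
      using ms ne y y' adj_commute by (simp add: ear_def successively_Cons successively_append_iff)
    then show False using noear ms(1) by blast
  qed
  have att_eq: "att w = b" if "R w b" for w b
    using that uniq by (auto simp: att_def intro: someI2)
  show thesis
  proof
    fix w
    show "att w \<in> B"
      using b0 att_eq[of w] by (cases "Ex (R w)") (auto simp: R_def att_def)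
  next
    fix w b assume "w \<in> V - B" "b \<in> B" "adj E w b"
    then have "R w b" by (auto simp: R_def)
    then show "att w = b" by (rule att_eq)
  next
    fix w w' assume w: "w \<in> V - B" "w' \<in> V - B" "adj E w w'"
    then have st: "(w, w') \<in> outside_step B" "(w', w) \<in> outside_step B"
      by (auto simp: outside_step_def adj_commute)
    have "R w = R w'"
      unfolding R_def fun_eq_iff using st by (meson converse_rtrancl_into_rtrancl)
    then show "att w = att w'" by (simp only: att_def)
  qed
qed

lemma edges_in_V: "edges_in E V = E"
  using G by (auto simp: edges_in_def graph_def)

lemma graph_edges_in: "S \<subseteq> V \<Longrightarrow> graph S (edges_in E S)"
  using G finV by (auto simp: graph_def edges_in_def intro: finite_subset)

text \<open>Every vertex of \<open>B\<close> carries one piece: itself and all outside vertices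
  attached to it, possibly none. The outside parts are disjoint, so their sizes sum to at most |V -
  B|.\<close>

lemma attached_G_family:
  assumes BV: "B \<subseteq> V" and proper: "\<And>x y. x \<in> B \<Longrightarrow> y \<in> B \<Longrightarrow> adj E x y \<Longrightarrow> c x \<noteq> (c y :: bool)"
    and att: "\<And>w. att w \<in> B" "\<And>w b. w \<in> V - B \<Longrightarrow> b \<in> B \<Longrightarrow> adj E w b \<Longrightarrow> att w = b"
    "\<And>w w'. w \<in> V - B \<Longrightarrow> w' \<in> V - B \<Longrightarrow> adj E w w' \<Longrightarrow> att w = att w'"
    and small: "card (V - B) + 2 \<le> r"
  shows "G_family (card V) r V E"
proof -
  have finB: "finite B" using BV finV finite_subset by blast
  obtain h where h: "bij_betw h {..<card B} B"
    using ex_bij_betw_nat_finite[OF finB] by (auto simp: atLeast0LessThan)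
  define P where "P i = {w \<in> V - B. att w = h i}" for i
  let ?GV = "\<lambda>i. insert (h i) (P i)"
  have hB: "h i \<in> B" if "i < card B" for i using h that by (auto simp: bij_betw_def)
  have ex: "\<exists>i<card B. h i = b" if "b \<in> B" for b
    using h that unfolding bij_betw_def by (metis (no_types, lifting) imageE lessThan_iff)
  have GV: "?GV i \<subseteq> V" "?GV i \<inter> B = {h i}" "?GV i - B = P i" if "i < card B" for i
    using hB[OF that] BV by (auto simp: P_def)
  have bip: "bipartite B (edges_in E B)"
    unfolding bipartite_def
  proof (intro exI[of _ "{x \<in> B. c x}"] conjI ballI)
    fix e assume e: "e \<in> edges_in E B"
    then obtain x y where xy: "e = {x, y}" "adj E x y" "x \<in> B" "y \<in> B"
      using edges_inE[OF G] by metis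
    then have "e \<inter> {x \<in> B. c x} = (if c x then {x} else {y})" using proper by auto
    then show "card (e \<inter> {x \<in> B. c x}) = 1" by simp
  qed auto
  have V_eq: "V = B \<union> (\<Union>i<card B. ?GV i)"
  proof (intro equalityI subsetI)
    fix v assume v: "v \<in> V"
    obtain i where "i < card B" "h i = att v" using ex att(1) by blast
    then have "v \<in> B \<or> i < card B \<and> v \<in> ?GV i" using v by (auto simp: P_def)
    then show "v \<in> B \<union> (\<Union>i<card B. ?GV i)" by blast
  qed (use BV hB in \<open>auto simp: P_def\<close>)
  have pieces: "e \<in> edges_in E B \<union> (\<Union>i<card B. edges_in E (?GV i))" if e: "e \<in> E" for e
  proof -
    obtain x y where xy: "e = {x, y}" "x \<in> V" "y \<in> V" "adj E x y" "adj E y x"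
      using graph_edgeE[OF G e] e by (metis insert_commute)
    show ?thesis
    proof (cases "x \<in> B \<and> y \<in> B")
      case True
      then show ?thesis using e xy by (auto simp: edges_in_def)
    next
      case False
      then obtain w where w: "w \<in> {x, y}" "w \<in> V - B" using xy by blast
      obtain i where i: "i < card B" "h i = att w" using ex att(1) by blast
      have "z \<in> ?GV i" if "z \<in> V" "adj E w z" for z
        using att(2)[of w z] att(3)[of w z] w i that by (cases "z \<in> B") (auto simp: P_def)
      moreover have "w \<in> ?GV i" using w i by (simp add: P_def)
      ultimately have "x \<in> ?GV i" "y \<in> ?GV i" using w xy by auto
      then have "e \<in> edges_in E (?GV i)" using e xy by (auto simp: edges_in_def)
      then show ?thesis using i by blast
    qed
  qed
  have E_eq: "E = edges_in E B \<union> (\<Union>i<card B. edges_in E (?GV i))"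
    using pieces by (auto simp: edges_in_def)
  have disj: "P i \<inter> P j = {}" if "i < card B" "j < card B" "i \<noteq> j" for i j
    using h that by (auto simp: P_def bij_betw_def inj_on_def)
  have "(\<Sum>i<card B. card (?GV i - B)) = (\<Sum>i<card B. card (P i))"
    using GV(3) by (intro sum.cong) auto
  also have "\<dots> = card (\<Union>i<card B. P i)"
    using finV disj by (intro card_UN_disjoint[symmetric]) (auto simp: P_def)
  also have "\<dots> \<le> card (V - B)"
    using finV by (intro card_mono) (auto simp: P_def)
  finally have "(\<Sum>i<card B. card (?GV i - B)) + 2 \<le> r" using small by simp
  moreover have "\<forall>i<card B. graph (?GV i) (edges_in E (?GV i)) \<and> card (?GV i \<inter> B) = 1"
    using GV(1,2) graph_edges_in by simp
  ultimately have "graph B (edges_in E B) \<and> bipartite B (edges_in E B)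
      \<and> (\<forall>i<card B. graph (?GV i) (edges_in E (?GV i)) \<and> card (?GV i \<inter> B) = 1)
      \<and> V = B \<union> (\<Union>i<card B. ?GV i) \<and> E = edges_in E B \<union> (\<Union>i<card B. edges_in E (?GV i))
      \<and> (\<Sum>i<card B. card (?GV i - B)) + 2 \<le> r"
    using graph_edges_in[OF BV] bip V_eq E_eq by blast
  then show ?thesis
    unfolding G_family_def
    by (intro conjI[OF G] conjI[OF refl] exI[of _ B] exI[of _ "edges_in E B"] exI[of _ "card B"]
        exI[of _ ?GV] exI[of _ "\<lambda>i. edges_in E (?GV i)"])
qed

text \<open>Attaining the bipartite maximum forces all pairs between the colour classes to be edges
  and the classes to be balanced. The clique is \<open>b\<close> with the whole outside.\<close>

lemma suspended_T_with_Kr: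
  assumes BV: "B \<subseteq> V" and proper: "\<And>x y. x \<in> B \<Longrightarrow> y \<in> B \<Longrightarrow> adj E x y \<Longrightarrow> c x \<noteq> (c y :: bool)"
    and b: "b \<in> B" and card_out: "card (V - B) + 1 = r"
    and full: "(card B)\<^sup>2 div 4 \<le> card (edges_in E B)"
    and complete: "\<And>w w'. w \<in> V - B \<Longrightarrow> w' \<in> V - B \<Longrightarrow> w \<noteq> w' \<Longrightarrow> adj E w w'"
    and one: "\<And>w x. w \<in> V - B \<Longrightarrow> x \<in> B \<Longrightarrow> adj E w x \<longleftrightarrow> x = b"
  shows "T_with_Kr (card V) r V E"
proof -
  define X where "X = {x \<in> B. c x}"
  define Y where "Y = {x \<in> B. \<not> c x}"
  have finB: "finite B" using BV finV finite_subset by blast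
  have XY: "X \<inter> Y = {}" "B = X \<union> Y" "finite X" "finite Y"
    using finB by (auto simp: X_def Y_def)
  let ?P = "(\<lambda>(x, y). {x, y}) ` (X \<times> Y)"
  have sub: "edges_in E B \<subseteq> ?P"
  proof
    fix e assume e: "e \<in> edges_in E B"
    then obtain x y where xy: "e = {x, y}" "adj E x y" "x \<in> B" "y \<in> B"
      using edges_inE[OF G] by metis
    then have "x \<in> X \<and> y \<in> Y \<or> y \<in> X \<and> x \<in> Y"
      using proper[of x y] by (auto simp: X_def Y_def)
    then show "e \<in> ?P" using xy(1) by (auto simp: insert_commute)
  qed
  have finP: "finite ?P" using XY by blast
  have cP: "card ?P = card X * card Y"
    using card_edges_between[of X Y "X \<times> Y"] XY by (simp add: card_cartesian_product)
  have cB: "card B = card X + card Y" using XY by (simp add: card_Un_disjoint)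
  have "card (edges_in E B) \<le> card X * card Y" using card_mono[OF finP sub] cP by simp
  moreover have "card X * card Y \<le> (card B)\<^sup>2 div 4" using mult_le_square_div4 cB by simp
  ultimately have eq: "card X * card Y = (card B)\<^sup>2 div 4" "card (edges_in E B) = card ?P"
    using full cP by auto
  then have EB: "edges_in E B = ?P" using card_subset_eq[OF finP sub] by simp
  define K where "K = insert b (V - B)"
  have bV: "b \<in> V" using b BV by blast
  have E_eq: "E = ?P \<union> {e. e \<subseteq> K \<and> card e = 2}"
  proof (intro equalityI subsetI)
    fix e assume e: "e \<in> E"
    obtain x y where xy: "e = {x, y}" "x \<noteq> y" "x \<in> V" "y \<in> V" "adj E x y" "adj E y x"
      using graph_edgeE[OF G e] e by (metis insert_commute)
    show "e \<in> ?P \<union> {e. e \<subseteq> K \<and> card e = 2}"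
    proof (cases "x \<in> B \<and> y \<in> B")
      case True
      then have "e \<in> edges_in E B" using e xy by (auto simp: edges_in_def)
      then show ?thesis using EB by blast
    next
      case False
      then have "x \<in> K" "y \<in> K" using xy one[of x y] one[of y x] by (auto simp: K_def)
      then show ?thesis using xy by simp
    qed
  next
    fix e assume "e \<in> ?P \<union> {e. e \<subseteq> K \<and> card e = 2}"
    then consider "e \<in> edges_in E B" | "e \<subseteq> K" "card e = 2" using EB by blast
    then show "e \<in> E"
    proof cases
      case 1
      then show ?thesis by (simp add: edges_in_def)
    next
      case 2
      then obtain x y where xy: "e = {x, y}" "x \<noteq> y" "x \<in> K" "y \<in> K"
        by (metis card_2_iff insert_subset)
      then show ?thesis
        using complete[of x y] one[of x b] one[of y b] b by (auto simp: K_def insert_commute)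
    qed
  qed
  have KB: "K \<inter> (X \<union> Y) = {b}" using b XY(2) by (auto simp: K_def)
  have cK: "card K = r" "finite K" using card_out b finV by (auto simp: K_def)
  have "card V = card B + card (V - B)" using BV finB finV
    by (metis card_Diff_subset card_mono le_add_diff_inverse)
  then have m: "card V - r + 1 = card B" using card_out b finB card_gt_0_iff[of B] by force
  have V_eq: "V = X \<union> Y \<union> K" using BV XY(2) bV by (auto simp: K_def)
  have P1: "?P = {{x, y} | x y. x \<in> X \<and> y \<in> Y}" "?P = {{x, y} | x y. x \<in> Y \<and> y \<in> X}"
    by (auto simp: insert_commute)
  \<comment> \<open>Either class may be the smaller one, and \<open>T_with_Kr\<close> lists the
    smaller one first; hence the exchange of \<open>X\<close> and \<open>Y\<close> in the second
    case.\<close>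
  have "card X = card B div 2 \<or> card Y = card B div 2"
    using balanced_factors[of "card X" "card Y"] eq(1) cB by simp
  then show ?thesis
  proof
    assume "card X = card B div 2"
    then have "card X = card B div 2" "card Y = card B - card B div 2" using cB by auto
    then show ?thesis unfolding T_with_Kr_def m
      using XY(1,3,4) KB cK E_eq V_eq unfolding P1(1)
      by (intro exI[of _ X] exI[of _ Y] exI[of _ K] conjI) simp_all
  next
    assume "card Y = card B div 2"
    then have "card Y = card B div 2" "card X = card B - card B div 2" using cB by auto
    moreover have "Y \<inter> X = {}" "K \<inter> (Y \<union> X) = {b}" "V = Y \<union> X \<union> K"
      using XY(1) KB V_eq by auto
    ultimately show ?thesis unfolding T_with_Kr_def m
      using XY(3,4) cK E_eq unfolding P1(2)
      by (intro exI[of _ Y] exI[of _ X] exI[of _ K] conjI) simp_all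
  qed
qed

lemma card_edges_bipartite:
  assumes "B \<subseteq> V" "\<And>x y. x \<in> B \<Longrightarrow> y \<in> B \<Longrightarrow> adj E x y \<Longrightarrow> c x \<noteq> (c y :: bool)"
  shows "card (edges_in E B) \<le> (card B)\<^sup>2 div 4"
proof -
  define X where "X = {x \<in> B. c x}"
  define Y where "Y = {x \<in> B. \<not> c x}"
  have XY: "X \<inter> Y = {}" "B = X \<union> Y" "finite X" "finite Y"
    using finite_subset[OF assms(1) finV] by (auto simp: X_def Y_def)
  have ind: "x \<in> X \<longleftrightarrow> y \<in> Y" if "x \<in> X \<union> Y" "y \<in> X \<union> Y" "adj E x y" for x y
    using assms(2)[of x y] that by (auto simp: X_def Y_def)
  have "card (edges_in E B) \<le> card X * card Y"
    using card_edges_bipartite_missing[OF G XY(3,4,1) ind, of "{}" "{}"] XY(2) by simp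
  also have "\<dots> \<le> (card B)\<^sup>2 div 4"
    using mult_le_square_div4[of "card X" "card Y"] XY by (simp add: card_Un_disjoint)
  finally show ?thesis .
qed

text \<open>Bounding the edges inside \<open>B\<close>, inside the outside \<open>R\<close>, and
  between them (at most one per vertex of \<open>R\<close>) gives \<open>edge_bound\<close> at |R|.
  Its monotonicity yields |R| <= r - 1, and equality there makes all three bounds tight.\<close>

lemma structure_without_ears:
  assumes BV: "B \<subseteq> V" and proper: "\<And>x y. x \<in> B \<Longrightarrow> y \<in> B \<Longrightarrow> adj E x y \<Longrightarrow> c x \<noteq> (c y :: bool)"
    and noear: "\<forall>p ms q. ear B p ms q \<longrightarrow> ms = []" and ne: "B \<noteq> {}"
    and out: "3 * card (V - B) + 2 \<le> card V" and r: "3 \<le> r" "r \<le> card V"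
    and many: "edge_bound (card V) (r - 1) \<le> card E"
  shows "G_family (card V) r V E \<or> T_with_Kr (card V) r V E"
proof -
  have finB: "finite B" using BV finV finite_subset by blast
  define R where "R = V - B"
  have R: "finite R" "B \<inter> R = {}" "V = B \<union> R" using BV finV by (auto simp: R_def)
  have cV: "card V = card B + card R" using R finB by (simp add: card_Un_disjoint)
  obtain att where att: "\<And>w. att w \<in> B"
    "\<And>w b. w \<in> V - B \<Longrightarrow> b \<in> B \<Longrightarrow> adj E w b \<Longrightarrow> att w = b"
    "\<And>w w'. w \<in> V - B \<Longrightarrow> w' \<in> V - B \<Longrightarrow> adj E w w' \<Longrightarrow> att w = att w'"
    using attachment_map[OF noear ne] by blast
  have sub: "nbrs E B w \<subseteq> {att w}" if "w \<in> R" for w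
    using att(2) that by (auto simp: nbrs_def R_def)
  have le1: "card (nbrs E B w) \<le> 1" if "w \<in> R" for w
    using card_mono[OF _ sub[OF that]] by simp
  have eE: "card E = card (edges_in E B) + card (edges_in E R) + (\<Sum>w\<in>R. card (nbrs E B w))"
    using card_edges_in_Un[OF G finB R(1,2)] R(3) edges_in_V by simp
  have eB: "card (edges_in E B) \<le> (card B)\<^sup>2 div 4"
    using card_edges_bipartite[OF BV proper] .
  have eR: "card (edges_in E R) \<le> card R choose 2" using card_edges_in_le[OF G R(1)] .
  have s: "(\<Sum>w\<in>R. card (nbrs E B w)) \<le> (\<Sum>w\<in>R. 1)" by (rule sum_mono) (rule le1)
  have bound: "edge_bound (card V) (card R) = (card B)\<^sup>2 div 4 + card R + (card R choose 2)"
    using cV choose_2_Suc[of "card R"] by (simp add: edge_bound_def)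
  have E_le: "card E \<le> edge_bound (card V) (card R)"
    using eE eB eR s bound by simp
  have "card R \<le> r - 1"
    using edge_bound_less[of "r - 1" "card R" "card V"] E_le many out by (force simp: R_def)
  then consider "card R + 2 \<le> r" | "card R = r - 1" using r by linarith
  then show ?thesis
  proof cases
    case 1
    then have "G_family (card V) r V E"
      using attached_G_family[OF BV proper att] by (simp add: R_def)
    then show ?thesis by blast
  next
    case 2
    then have "card E = edge_bound (card V) (card R)" using E_le many by simp
    then have tight: "card (edges_in E B) = (card B)\<^sup>2 div 4" "card (edges_in E R) = card R choose 2"
      "(\<Sum>w\<in>R. card (nbrs E B w)) = (\<Sum>w\<in>R. 1)"
      using eE eB eR s bound by auto
    have complete: "adj E w w'" if "w \<in> R" "w' \<in> R" "w \<noteq> w'" for w w'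
      using card_edges_in_less[OF G R(1) that] tight(2) by linarith
    have "card (nbrs E B w) = 1" if "w \<in> R" for w
    proof (rule ccontr)
      assume "card (nbrs E B w) \<noteq> 1"
      then have "card (nbrs E B w) < 1" using le1[OF that] by linarith
      then have "(\<Sum>w\<in>R. card (nbrs E B w)) < (\<Sum>w\<in>R. 1)"
        using le1 that R(1) by (intro sum_strict_mono_ex1) auto
      then show False using tight(3) by simp
    qed
    then have nb: "nbrs E B w = {att w}" if "w \<in> R" for w
      using sub[OF that] that by (metis card.empty subset_singletonD zero_neq_one)
    have "R \<noteq> {}" using 2 r by auto
    then obtain w0 where w0: "w0 \<in> R" by blast
    \<comment> \<open>Since \<open>R\<close> is complete, every other vertex of it is adjacent to
      \<open>w0\<close> and shares its attachment vertex.\<close>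
    have same: "att w = att w0" if "w \<in> R" for w
      using att(3)[of w w0] complete[of w w0] that w0 by (cases "w = w0") (auto simp: R_def)
    have one: "adj E w x \<longleftrightarrow> x = att w0" if "w \<in> R" "x \<in> B" for w x
      using nb[OF that(1)] same[OF that(1)] that(2) by (auto simp: nbrs_def)
    have "T_with_Kr (card V) r V E"
      using suspended_T_with_Kr[OF BV proper att(1)[of w0], where r = r] complete one tight(1) 2 r
      by (simp add: R_def)
    then show ?thesis by blast
  qed
qed

end


section \<open>A shortest bad ear\<close>

text \<open>Collects what maximality of \<open>U\<close> and the edge count provide;
  \<open>dense_core\<close> constructs an instance.\<close>

locale colored_core = core V E k U for V :: "'a set" and E k U +
  fixes col :: "'a \<Rightarrow> bool"
  assumes proper: "\<And>x y. x \<in> U \<Longrightarrow> y \<in> U \<Longrightarrow> adj E x y \<Longrightarrow> col x \<noteq> col y"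
    and deg_out: "\<And>v. v \<in> V - U \<Longrightarrow> 3 * card (nbrs E U v) \<le> card U + 1 + 6 * k"
    and out: "card (V - U) < 7 * k"
    and big: "100 * k \<le> card V"
begin

text \<open>A neighbour of \<open>x\<close> has its whole neighbourhood in the class of
  \<open>x\<close>, so the opposite class has at most (2|U| - 6k) / 3 vertices. It contains both
  \<open>N x\<close> and \<open>N y\<close>, which must overlap in at least 6k vertices.\<close>

lemma linked_if_same_colour:
  assumes "x \<in> U" "y \<in> U" "x \<noteq> y" "col x = col y"
  shows "linked x y"
proof -
  define S where "S = {z \<in> U. col z = col x}"
  define O' where "O' = {z \<in> U. col z \<noteq> col x}"
  have fin: "finite S" "finite O'" using finU by (auto simp: S_def O'_def)
  have "U = S \<union> O'" "S \<inter> O' = {}" by (auto simp: S_def O'_def)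
  then have cU: "card U = card S + card O'" using fin by (simp add: card_Un_disjoint)
  have "card (N x) \<noteq> 0" using deg_core[OF assms(1)] k by auto
  then obtain z where z: "z \<in> N x" by fastforce
  then have zU: "z \<in> U" "col z \<noteq> col x" using proper[of x z] assms by (auto simp: nbrs_def)
  have "N z \<subseteq> S" using proper[of z] zU by (auto simp: nbrs_def S_def)
  then have S: "card U + 6 * k \<le> 3 * card S"
    using card_mono[OF fin(1)] deg_core[OF zU(1)] by (meson le_trans mult_le_mono2)
  have "N x \<union> N y \<subseteq> O'" using proper assms by (fastforce simp: nbrs_def O'_def)
  then have "card (N x \<union> N y) \<le> card O'" using card_mono[OF fin(2)] by blast
  then have "2 * k \<le> card (N x \<inter> N y)"
    using card_Un_Int[OF finN[of x] finN[of y]] S cU deg_core[OF assms(1)] deg_core[OF assms(2)]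
    by linarith
  then show ?thesis using assms(3) by (simp add: linked_def)
qed

lemma no_closing_path:
  assumes "ear U p ms q" "successively (adj E) (q # ps @ [p])" "distinct (q # ps @ [p])"
    "set ps \<subseteq> U" "length ms + length ps + 1 = 2 * k"
  shows False
proof (rule no_odd_cycle)
  show "length (p # ms @ q # ps) = 2 * k + 1" using assms(5) by simp
  show "distinct (p # ms @ q # ps)" "set (p # ms @ q # ps) \<subseteq> V"
    using assms UV by (auto simp: ear_def)
  have "successively (adj E) (q # ps)" "adj E (last (q # ps)) p"
    using assms(2) successively_append_iff[of "adj E" "q # ps" "[p]"] by auto
  then show "successively (adj E) (p # ms @ q # ps)" "adj E (last (p # ms @ q # ps)) (hd (p # ms @ q # ps))"
    using assms(1) successively_append_Cons[of "adj E" "p # ms" q ps] by (auto simp: ear_def)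
qed

text \<open>A shorter bad ear closes up to a forbidden cycle. With even interior its ends have the
  same colour and an even path joins them; with odd interior the colours differ, and one step from
  \<open>q\<close> to a neighbour \<open>x\<close> restores equality.\<close>

lemma bad_ear_long:
  assumes e: "ear U p ms q" and bad: "\<not> good col p ms q"
  shows "2 * k \<le> length ms + 1"
proof (rule ccontr)
  assume short: "\<not> ?thesis"
  have pq: "p \<in> U" "q \<in> U" "p \<noteq> q" using e by (auto simp: ear_def)
  show False
  proof (cases "even (length ms)")
    case True
    then obtain i where i: "length ms = 2 * i" by blast
    have cc: "col q = col p" using bad True by (auto simp: good_def)
    have "1 \<le> k - i" "card {} + 2 * (k - i) \<le> 2 * k" using short i by auto
    then obtain ps where ps: "length ps = 2 * (k - i) - 1" "distinct (q # ps @ [p])"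
      "set ps \<subseteq> U - {}" "successively (adj E) (q # ps @ [p])"
      using even_path[OF linked_if_same_colour[OF pq(2,1) pq(3)[symmetric] cc] pq(2,1), of "{}" "k - i"]
      by blast
    have "length ms + length ps + 1 = 2 * k" using ps(1) i short by linarith
    then show False using no_closing_path[OF e ps(4,2)] ps(3) by blast
  next
    case False
    then obtain i where i: "length ms = 2 * i + 1" using oddE by blast
    have cc: "col p \<noteq> col q" using bad False by (auto simp: good_def)
    have "\<not> N q \<subseteq> {p}"
      using card_mono[of "{p}" "N q"] deg_core[OF pq(2)] k by fastforce
    then obtain x where x: "x \<in> U" "adj E q x" "x \<noteq> p" by (auto simp: nbrs_def)
    have xq: "x \<noteq> q" "col x = col p" using x cc proper[OF pq(2) x(1)] adj_neq by auto
    have "1 \<le> k - i - 1" "card {q} + 2 * (k - i - 1) \<le> 2 * k" "x \<notin> {q}" "p \<notin> {q}"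
      using short i xq pq by auto
    then obtain ps where ps: "length ps = 2 * (k - i - 1) - 1" "distinct (x # ps @ [p])"
      "set ps \<subseteq> U - {q}" "successively (adj E) (x # ps @ [p])"
      using even_path[OF linked_if_same_colour[OF x(1) pq(1) x(3) xq(2)] x(1) pq(1), of "{q}" "k - i - 1"]
      by blast
    have "length ms + length (x # ps) + 1 = 2 * k" using ps(1) i short by auto
    moreover have "successively (adj E) (q # (x # ps) @ [p])" "distinct (q # (x # ps) @ [p])"
      "set (x # ps) \<subseteq> U"
      using ps x xq pq by auto
    ultimately show False using no_closing_path[OF e] by blast
  qed
qed

section \<open>Neighbourhoods along a shortest bad ear\<close>

definition shortest_bad :: "'a \<Rightarrow> 'a list \<Rightarrow> 'a \<Rightarrow> bool" where
  "shortest_bad p ms q \<longleftrightarrow> ear U p ms q \<and> \<not> good col p ms q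
    \<and> (\<forall>p' ms' q'. ear U p' ms' q' \<longrightarrow> length ms' < length ms \<longrightarrow> good col p' ms' q')"

lemma shortest_bad_rev: "shortest_bad p ms q \<Longrightarrow> shortest_bad q (rev ms) p"
  by (simp add: shortest_bad_def ear_rev good_rev)

lemma shortest_badD:
  assumes "shortest_bad p ms q" "ear U p' ms' q'" "length ms' < length ms"
  shows "col p' = col q' \<longleftrightarrow> odd (length ms')"
  using assms by (auto simp: shortest_bad_def good_def)

lemma shortest_bad_length: "shortest_bad p ms q \<Longrightarrow> 2 * k \<le> length ms + 1"
  using bad_ear_long by (auto simp: shortest_bad_def)

lemma ear_prefix:
  assumes "ear U p (A @ x # C) q" "b \<in> N x" "b \<noteq> p"
  shows "ear U p (A @ [x]) b"
  using assms successively_append_Cons[of "adj E" "p # A" x "C @ [q]"]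
    successively_append_Cons[of "adj E" "p # A" x "[b]"]
  by (auto simp: ear_def nbrs_def)

lemma ear_suffix:
  assumes "ear U p (A @ x # C) q" "b \<in> N x" "b \<noteq> q"
  shows "ear U b (x # C) q"
proof -
  have "ear U q (rev C @ x # rev A) p" using assms(1) ear_rev[of U q "A @ x # C" p] by simp
  from ear_prefix[OF this assms(2,3)] show ?thesis
    using ear_rev[of U q "x # C" b] by simp
qed

text \<open>A neighbour other than \<open>p\<close> and \<open>q\<close> would split the ear into
  two shorter, hence good, ears, whose parities combine to make the whole ear good. If both
  \<open>p\<close> and \<open>q\<close> were neighbours, the ear through \<open>x\<close> alone
  would be good too, and the parities clash.\<close>

lemma mid_nbrs:
  assumes sb: "shortest_bad p ms q" and ms: "ms = A @ x # C" "A \<noteq> []" "C \<noteq> []"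
  shows "N x \<subseteq> {p, q} \<and> card (N x) \<le> 1"
proof -
  have e: "ear U p (A @ x # C) q" and bad: "\<not> good col p ms q"
    using sb ms by (auto simp: shortest_bad_def)
  have pre: "col p = col b \<longleftrightarrow> odd (length A + 1)" if "b \<in> N x" "b \<noteq> p" for b
    using shortest_badD[OF sb ear_prefix[OF e that]] ms by simp
  have suf: "col b = col q \<longleftrightarrow> odd (length C + 1)" if "b \<in> N x" "b \<noteq> q" for b
    using shortest_badD[OF sb ear_suffix[OF e that]] ms by simp
  have sub: "N x \<subseteq> {p, q}"
  proof
    fix b assume "b \<in> N x"
    then show "b \<in> {p, q}" using pre[of b] suf[of b] bad ms by (auto simp: good_def)
  qed
  have pq: "p \<noteq> q" using e by (auto simp: ear_def)
  have "\<not> (p \<in> N x \<and> q \<in> N x)"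
  proof
    assume b: "p \<in> N x \<and> q \<in> N x"
    then have "ear U p [x] q"
      using e by (auto simp: ear_def nbrs_def adj_commute)
    then have "col p = col q" using shortest_badD[OF sb, of p "[x]" q] ms by (cases A) auto
    then show False using pre[of q] suf[of p] b pq bad ms by (auto simp: good_def)
  qed
  then have "N x \<subseteq> {p} \<or> N x \<subseteq> {q}" using sub by blast
  then have "card (N x) \<le> 1" using card_mono[of "{p}" "N x"] card_mono[of "{q}" "N x"] by auto
  then show ?thesis using sub by blast
qed

lemma first_nbrs_colour:
  assumes sb: "shortest_bad p (a # M @ [z]) q" and b: "b \<in> N a"
  shows "col b = col p"
proof (cases "b = p")
  case False
  have "ear U p [a] b"
    using ear_prefix[of p "[]" a "M @ [z]" q b] sb b False by (simp add: shortest_bad_def)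
  then show ?thesis using shortest_badD[OF sb, of p "[a]" b] by simp
qed simp

lemma last_nbrs_colour:
  assumes sb: "shortest_bad p (a # M @ [z]) q" and b: "b \<in> N z"
  shows "col b = col q"
  using first_nbrs_colour[of q z "rev M" a p b] shortest_bad_rev[OF sb] b by simp

lemma end_in_nbrs:
  assumes "shortest_bad p (a # M @ [z]) q"
  shows "p \<in> N a" "q \<in> N z"
proof -
  have "p \<in> U" "q \<in> U" "successively (adj E) (p # (a # M) @ [z] @ [q])"
    using assms by (auto simp: shortest_bad_def ear_def)
  then show "p \<in> N a" "q \<in> N z"
    using successively_append_Cons[of "adj E" "p # a # M" z "[q]"]
    by (auto simp: nbrs_def adj_commute)
qed

lemma ear_replace_ends:
  assumes "ear U p (a # M @ [z]) q" "b \<in> N a" "b' \<in> N z" "b \<noteq> b'"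
  shows "ear U b (a # M @ [z]) b'"
proof -
  have "successively (adj E) ((a # M) @ [z])"
    using assms(1) successively_append_Cons[of "adj E" "a # M" z "[q]"] by (auto simp: ear_def)
  moreover have "adj E b a" "adj E z b'" "b \<in> U" "b' \<in> U"
    using assms by (auto simp: nbrs_def adj_commute)
  ultimately have "successively (adj E) (b # (a # M @ [z]) @ [b'])"
    using successively_append_Cons[of "adj E" "a # M" z "[b']"] by simp
  then show ?thesis using assms \<open>b \<in> U\<close> \<open>b' \<in> U\<close> by (auto simp: ear_def)
qed

text \<open>With 2k - 1 interior vertices, such an edge would close a cycle with 2k + 1
  vertices.\<close>

lemma ends_not_joined:
  assumes sb: "shortest_bad p (a # M @ [z]) q" and len: "length (a # M @ [z]) + 1 = 2 * k"
    and b: "b \<in> N a" "b' \<in> N z"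
  shows "\<not> adj E b b'"
proof
  assume adj: "adj E b b'"
  have "ear U p (a # M @ [z]) q" using sb unfolding shortest_bad_def by blast
  from ear_replace_ends[OF this b adj_neq[OF adj]] show False
  proof (rule no_closing_path)
    show "successively (adj E) (b' # [] @ [b])" using adj by (simp add: insert_commute)
    show "distinct (b' # [] @ [b])" using adj_neq[OF adj] by auto
  qed (use len in auto)
qed

lemma ends_disjoint:
  assumes sb: "shortest_bad p (a # M @ [z]) q" and len: "length (a # M @ [z]) = 2 * k"
  shows "N a \<inter> N z = {}"
proof (rule ccontr)
  assume "N a \<inter> N z \<noteq> {}"
  then obtain b where b: "b \<in> U" "adj E b a" "adj E z b" by (auto simp: nbrs_def adj_commute)
  have e: "distinct (a # M @ [z])" "set (a # M @ [z]) \<subseteq> V - U"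
    "successively (adj E) (p # (a # M @ [z]) @ [q])"
    using sb by (auto simp: shortest_bad_def ear_def)
  show False
  proof (rule no_odd_cycle)
    show "length (b # a # M @ [z]) = 2 * k + 1" using len by simp
    show "distinct (b # a # M @ [z])" "set (b # a # M @ [z]) \<subseteq> V" using e b UV by auto
    show "successively (adj E) (b # a # M @ [z])"
      using e(3) b successively_append_Cons[of "adj E" "a # M" z "[q]"] by auto
    show "adj E (last (b # a # M @ [z])) (hd (b # a # M @ [z]))" using b by simp
  qed
qed

text \<open>Otherwise both the ear from \<open>b\<close> through \<open>a\<close> to
  \<open>x\<close> and back to \<open>p\<close>, and the ear from \<open>p\<close> directly to
  \<open>x\<close> and on to \<open>q\<close>, are shorter than the bad ear. As \<open>b\<close> and
  \<open>p\<close> have the same colour, their parities contradict badness.\<close>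

lemma mid_not_adj_first:
  assumes sb: "shortest_bad p (a # M @ [z]) q" and ev: "even (length M)"
    and b: "b \<in> N a" "b \<noteq> p" and x: "x \<in> set M"
  shows "p \<notin> N x"
proof
  assume px: "p \<in> N x"
  obtain A C where M: "M = A @ x # C" using x split_list by fast
  have e: "ear U p ((a # A) @ x # C @ [z]) q" and bad: "\<not> good col p (a # M @ [z]) q"
    using sb M by (auto simp: shortest_bad_def)
  have pq: "p \<noteq> q" using e by (auto simp: ear_def)
  have "ear U p (x # C @ [z]) q" using ear_suffix[OF e px pq] .
  then have 1: "col p = col q \<longleftrightarrow> odd (length C)" using shortest_badD[OF sb] M by fastforce
  have "successively (adj E) (p # (a # A) @ [x])"
    using e successively_append_Cons[of "adj E" "p # a # A" x "C @ [z] @ [q]"] by (auto simp: ear_def)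
  then have "successively (adj E) (b # (a # A @ [x]) @ [p])"
    using b px successively_append_Cons[of "adj E" "b # a # A" x "[p]"]
    by (auto simp: nbrs_def adj_commute)
  then have "ear U b (a # A @ [x]) p" using e b by (auto simp: ear_def nbrs_def)
  then have "col b = col p \<longleftrightarrow> odd (length A + 2)" using shortest_badD[OF sb] M by fastforce
  moreover have "col b = col p" using first_nbrs_colour[OF sb b(1)] .
  ultimately show False using 1 ev bad M by (auto simp: good_def)
qed

text \<open>The chord would give an ear with interior \<open>a\<close>, \<open>z\<close> only, which
  is shorter and so good, but has the same parity.\<close>

lemma ends_not_adj:
  assumes sb: "shortest_bad p (a # M @ [z]) q" and ev: "even (length M)" and ne: "M \<noteq> []"
  shows "\<not> adj E a z"
proof
  assume az: "adj E a z"
  have "ear U p [a, z] q"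
    using sb az end_in_nbrs[OF sb] by (auto simp: shortest_bad_def ear_def nbrs_def adj_commute)
  then have "col p \<noteq> col q" using shortest_badD[OF sb] ne by fastforce
  then show False using sb ev by (auto simp: shortest_bad_def good_def)
qed

text \<open>The edges within \<open>U\<close>, within the outside and between them are compared with
  the bound. The expensive vertices are \<open>a\<close> and \<open>z\<close>, which may have about
  |U| / 3 neighbours each; how they are paid for depends on the ear length.\<close>

lemma few_edges_if_bad_ear:
  assumes sb: "shortest_bad p ms q"
  shows "card E < edge_bound (card V) (2 * k - 1)"
proof -
  define R where "R = V - U - set ms"
  define u where "u = card U"
  define w where "w = card (V - U)"
  define s where "s = length ms"
  define o' where "o' = card R"
  have e: "ear U p ms q" and bad: "\<not> good col p ms q" using sb by (auto simp: shortest_bad_def)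
  have len: "2 * k \<le> s + 1" using shortest_bad_length[OF sb] by (simp add: s_def)
  then have l3: "length ms \<ge> 3" using k by (simp add: s_def)
  obtain a ms' where "ms = a # ms'" using l3 by (cases ms) auto
  moreover from this obtain M z where "ms' = M @ [z]" using l3 by (cases ms' rule: rev_cases) auto
  ultimately have ms: "ms = a # M @ [z]" by simp
  have Mne: "M \<noteq> []" using l3 ms by auto
  note sb' = sb[unfolded ms]
  have dist: "distinct ms" "set ms \<subseteq> V - U" using e by (auto simp: ear_def)
  have finR: "finite R" using finV by (simp add: R_def)
  have VU: "V - U = set ms \<union> R" "set ms \<inter> R = {}" using dist by (auto simp: R_def)
  have w: "w = s + o'"
    using VU finR distinct_card[OF dist(1)] by (simp add: w_def s_def o'_def card_Un_disjoint)
  have w7: "w < 7 * k" using out by (simp add: w_def)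
  have cV: "card V = u + w"
    using UV finU finV by (simp add: u_def w_def card_Diff_subset card_mono)
  have u93: "93 * k \<le> u" using cV w7 big by linarith
  have sumN: "(\<Sum>v\<in>V - U. card (N v)) =
      card (N a) + card (N z) + (\<Sum>v\<in>set M. card (N v)) + (\<Sum>v\<in>R. card (N v))"
    using VU dist(1) finR unfolding ms by (simp add: sum.union_disjoint)
  define SR where "SR = (\<Sum>v\<in>R. card (N v))"
  define SM where "SM = (\<Sum>v\<in>set M. card (N v))"
  have "V = U \<union> (V - U)" using UV by blast
  then have eE: "card E = card (edges_in E U) + card (edges_in E (V - U))
      + (card (N a) + card (N z) + SM + SR)"
    using card_edges_in_Un[OF G finU, of "V - U"] finV sumN edges_in_V by (simp add: SM_def SR_def)
  have SR: "3 * SR \<le> o' * (u + 1 + 6 * k)"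
  proof -
    have "3 * SR = (\<Sum>v\<in>R. 3 * card (N v))" by (simp add: SR_def sum_distrib_left)
    also have "\<dots> \<le> o' * (u + 1 + 6 * k)"
      using sum_bounded_above[of R "\<lambda>v. 3 * card (N v)" "u + 1 + 6 * k"] deg_out
      by (simp add: R_def o'_def u_def)
    finally show ?thesis .
  qed
  have mid: "N x \<subseteq> {p, q} \<and> card (N x) \<le> 1" if x: "x \<in> set M" for x
  proof -
    obtain A C where "M = A @ x # C" using x split_list by fast
    then show ?thesis using mid_nbrs[OF sb, of "a # A" x "C @ [z]"] ms by simp
  qed
  have "card (set M) = s - 2" using dist(1) by (simp add: ms s_def distinct_card)
  then have SM: "SM \<le> s - 2"
    using sum_bounded_above[of "set M" "\<lambda>v. card (N v)" 1] mid by (simp add: SM_def)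
  have eW: "card (edges_in E (V - U)) \<le> w choose 2"
    using card_edges_in_le[OF G] finV by (simp add: w_def)
  have deg_ends: "3 * card (N a) \<le> u + 1 + 6 * k" "3 * card (N z) \<le> u + 1 + 6 * k"
    using deg_out[of a] deg_out[of z] dist(2) ms by (auto simp: u_def)
  have eU: "card (edges_in E U) \<le> u\<^sup>2 div 4"
    using card_edges_bipartite[OF UV proper] by (simp add: u_def)
  have pa: "p \<in> N a" "q \<in> N z" using end_in_nbrs[OF sb'] by auto
  have pos: "1 \<le> card (N a)" "1 \<le> card (N z)"
    using pa finN by (metis One_nat_def Suc_leI card_gt_0_iff empty_iff)+
  have ku: "93 * (k * o') \<le> u * o'"
    using mult_le_mono1[OF u93, of o'] by (simp add: mult.assoc)
  have wo: "o' * w \<le> 7 * (k * o')" using w7 mult_le_mono2[of w "7 * k" o'] by (simp add: mult.commute mult.left_commute)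
  have SR': "3 * SR \<le> u * o' + o' + 6 * (k * o')" using SR by (simp add: algebra_simps)
  have ko: "2 * o' \<le> k * o'" using k by simp
  \<comment> \<open>A vertex of \<open>R\<close> sends about u / 3 edges to \<open>U\<close> and at
    most w < 7k to the outside, less than the u / 2 it adds to the bound.\<close>
  have rest2: "2 * SR + 2 * (o' * w) \<le> u * o'" using ku wo SR' ko by linarith
  then have rest: "2 * (SR + o' * w) \<le> u * o'" by simp
  \<comment> \<open>Besides \<open>U\<close>, the quadratic term of the bound covers
    \<open>o'\<close> vertices for \<open>R\<close> and s + 1 - 2k for the ear.\<close>
  have bound: "edge_bound (card V) (2 * k - 1) = (u + (o' + (s + 1 - 2 * k)))\<^sup>2 div 4 + (2 * k choose 2)"
    using cV w len k by (simp add: edge_bound_def algebra_simps)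
  define X where "X = {x \<in> U. col x = col p}"
  define Y where "Y = {x \<in> U. col x \<noteq> col p}"
  have XY: "X \<inter> Y = {}" "U = X \<union> Y" "finite X" "finite Y"
    using finU by (auto simp: X_def Y_def)
  have ind: "x \<in> X \<longleftrightarrow> y \<in> Y" if "x \<in> X \<union> Y" "y \<in> X \<union> Y" "adj E x y" for x y
    using proper[of x y] that by (auto simp: X_def Y_def)
  have uXY: "u = card X + card Y" using XY by (simp add: u_def card_Un_disjoint)
  have NX: "N a \<subseteq> X" using first_nbrs_colour[OF sb'] by (auto simp: X_def nbrs_def)
  consider "s + 1 = 2 * k" | "s = 2 * k" | "2 * k + 1 \<le> s" using len by linarith
  then show ?thesis
  proof cases
    case 1
    then have "odd (length ms)" using k by (metis dvd_triv_left even_add odd_one s_def)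
    then have cc: "col p \<noteq> col q" using bad by (auto simp: good_def)
    have NY: "N z \<subseteq> Y" using last_nbrs_colour[OF sb'] cc by (auto simp: Y_def nbrs_def)
    \<comment> \<open>No extra vertex is available here, but \<open>N a\<close> and
      \<open>N z\<close> lie in opposite classes without edges between them. The missing product is
      at least the sum of the two degrees minus 1.\<close>
    have "card (edges_in E U) + card (N a) * card (N z) \<le> card X * card Y"
      using card_edges_bipartite_missing[OF G XY(3,4,1) ind NX NY] ends_not_joined[OF sb'] 1 XY(2)
      by (simp add: ms s_def)
    moreover have "card (N a) + card (N z) \<le> card (N a) * card (N z) + 1"
    proof -
      obtain i j where "card (N a) = Suc i" "card (N z) = Suc j"
        using pos by (metis One_nat_def Suc_le_D)
      then show ?thesis by simp
    qed
    moreover have "card X * card Y \<le> u\<^sup>2 div 4" using mult_le_square_div4 uXY by simp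
    ultimately have A: "card (edges_in E U) + card (N a) + card (N z) \<le> u\<^sup>2 div 4 + 1" by linarith
    have "w choose 2 \<le> (s choose 2) + o' * w" using choose_2_add[of s o' w] w by simp
    moreover have "2 * k choose 2 = s + (s choose 2)" using 1 choose_2_Suc[of s] by simp
    moreover have "u\<^sup>2 div 4 + (SR + o' * w) \<le> (u + o')\<^sup>2 div 4"
      using square_div4_add_le[OF rest] .
    ultimately show ?thesis using A eE SM eW bound 1 l3 by (simp add: s_def)
  next
    case 2
    then have ev: "even (length ms)" by (simp add: s_def)
    then have evM: "even (length M)" by (simp add: ms)
    have bound': "edge_bound (card V) (2 * k - 1) = (u + (o' + 1))\<^sup>2 div 4 + (2 * k choose 2)"
      using bound 2 by simp
    have cc: "col q = col p" using bad ev by (auto simp: good_def)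
    have NX': "N z \<subseteq> X" using last_nbrs_colour[OF sb'] cc by (auto simp: X_def nbrs_def)
    have "N a \<inter> N z = {}" using ends_disjoint[OF sb'] 2 by (simp add: ms s_def)
    then have dX: "card (N a) + card (N z) \<le> card X"
      using card_mono[OF XY(3), of "N a \<union> N z"] NX NX' finN by (simp add: card_Un_disjoint)
    have wc: "w choose 2 \<le> (2 * k choose 2) + o' * w" using choose_2_add[of s o' w] w 2 by simp
    show ?thesis
    proof (cases "card (N a) \<le> 1 \<or> card (N z) \<le> 1")
      case True
      \<comment> \<open>Only one end can be expensive: about u / 3, below the u / 2 of the one extra
        vertex.\<close>
      have "3 * card (N a) + 3 * card (N z) \<le> u + 4 + 6 * k" using True deg_ends by linarith
      then have "2 * card (N a) + 2 * card (N z) + 2 * (2 * k - 2) + 2 * SR + 2 * (o' * w) + 2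
          \<le> u * o' + u"
        using rest2 u93 k by linarith
      then have "2 * (card (N a) + card (N z) + (2 * k - 2) + SR + o' * w) + 2 \<le> u * (o' + 1)"
        by simp
      from square_div4_add[OF this] show ?thesis
        using eE eU SM[unfolded 2] eW wc bound' by linarith
    next
      case False
      then have "\<not> N a \<subseteq> {p}" "\<not> N z \<subseteq> {q}"
        using card_mono[of "{p}" "N a"] card_mono[of "{q}" "N z"] by auto
      then obtain b b' where b: "b \<in> N a" "b \<noteq> p" "b' \<in> N z" "b' \<noteq> q" by blast
      \<comment> \<open>A second neighbour of \<open>a\<close> excludes \<open>p\<close> from
        \<open>N x\<close>, and by reversal one of \<open>z\<close> excludes
        \<open>q\<close>.\<close>
      have "N x = {}" if x: "x \<in> set M" for x
        using mid_not_adj_first[OF sb' evM b(1,2) x] mid[OF x]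
          mid_not_adj_first[of q z "rev M" a p b' x] shortest_bad_rev[OF sb'] evM b x by auto
      then have SM0: "SM = 0" by (simp add: SM_def)
      have "a \<noteq> z" "a \<in> V - U" "z \<in> V - U" using dist ms by auto
      then have "card (edges_in E (V - U)) < w choose 2"
        using card_edges_in_less[OF G] finV ends_not_adj[OF sb' evM Mne] by (simp add: w_def)
      \<comment> \<open>The disjoint sets \<open>N a\<close> and \<open>N z\<close> together act
        like one new vertex joined to all of \<open>X\<close>. Strictness comes from the missing
        edge \<open>az\<close>.\<close>
      moreover have "card (edges_in E U) + card X \<le> (u + 1)\<^sup>2 div 4"
      proof -
        have "card (edges_in E U) \<le> card X * card Y"
          using card_edges_bipartite_missing[OF G XY(3,4,1) ind, of "{}" "{}"] XY(2) by simp
        moreover have "card X * (card Y + 1) \<le> (card X + (card Y + 1))\<^sup>2 div 4"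
          by (rule mult_le_square_div4)
        ultimately show ?thesis using uXY by (simp add: algebra_simps)
      qed
      moreover have "(u + 1)\<^sup>2 div 4 + (SR + o' * w) \<le> (u + (o' + 1))\<^sup>2 div 4"
        using square_div4_add_le[of "SR + o' * w" "u + 1" o'] rest by (simp add: ac_simps)
      ultimately show ?thesis using eE SM0 dX wc bound' by linarith
    qed
  next
    case 3
    define d where "d = s - 2 * k"
    have d: "s = 2 * k + d" "1 \<le> d" using 3 by (auto simp: d_def)
    have wc: "w choose 2 \<le> (2 * k choose 2) + (d + o') * w"
      using choose_2_add[of "2 * k" "d + o'" w] w d by (simp add: add.assoc)
    have dw: "d * w \<le> 7 * (k * d)" using w7 mult_le_mono2[of w "7 * k" d] by (simp add: mult.commute mult.left_commute)
    \<comment> \<open>With d + 1 >= 2 extra vertices the gain is at least u, against about 2u / 3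
      for the two ends. All terms are scaled to clear the thirds.\<close>
    have "6 * (d * w) + 6 * s + 4 * u + 24 * k + 10 \<le> 3 * (u * d) + 3 * u"
    proof -
      have s7: "s \<le> 7 * k" using w w7 by simp
      obtain c where c: "d = Suc c" using d(2) by (cases d) auto
      have "93 * (k * c) \<le> u * c" using mult_le_mono1[OF u93, of c] by (simp add: mult.assoc)
      moreover have "k * d = k + k * c" "u * d = u + u * c" using c by simp_all
      ultimately show ?thesis using dw s7 u93 k by linarith
    qed
    then have "2 * card (N a) + 2 * card (N z) + 2 * (s - 2) + 2 * SR + 2 * (d * w) + 2 * (o' * w) + 2
        \<le> u * o' + u * d + u"
      using deg_ends rest2 by linarith
    then have "2 * (card (N a) + card (N z) + (s - 2) + SR + (d + o') * w) + 2 \<le> u * (o' + (d + 1))"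
      by (simp add: algebra_simps)
    from square_div4_add[OF this] have "u\<^sup>2 div 4 + (card (N a) + card (N z) + (s - 2) + SR + (d + o') * w)
        < (u + (o' + (d + 1)))\<^sup>2 div 4" .
    moreover have "edge_bound (card V) (2 * k - 1) = (u + (o' + (d + 1)))\<^sup>2 div 4 + (2 * k choose 2)"
      using bound d by simp
    ultimately show ?thesis
      using eE eU SM eW wc by linarith
  qed
qed

end

section \<open>The dense core\<close>

context odd_cycle_free
begin

text \<open>Removing a vertex of small degree from the maximiser of \<open>\<phi>\<close>, or adding one of large degree,
  would increase \<open>\<phi>\<close>.\<close>

lemma dense_core:
  assumes big: "100 * k \<le> card V" and many: "edge_bound (card V) (2 * k - 1) \<le> card E"
  shows "\<exists>U col. colored_core V E k U col"
proof -
  \<comment> \<open>Inserting a vertex of degree t into \<open>S\<close> changes the value by 6t -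
    2|S| - 2 - 12k, so maximality gives the degree thresholds near (|U| + 6k) / 3.\<close>
  define \<phi> :: "'a set \<Rightarrow> int" where
    "\<phi> S = 6 * int (card (edges_in E S)) - int (card S) ^ 2 - int (card S)
      - 12 * int k * int (card S)" for S
  have fin: "finite (\<phi> ` Pow V)" "\<phi> ` Pow V \<noteq> {}" using finV by auto
  obtain U where U: "U \<subseteq> V" "\<phi> U = Max (\<phi> ` Pow V)" using Max_in[OF fin] by auto
  have max: "\<phi> S \<le> \<phi> U" if "S \<subseteq> V" for S using U(2) Max_ge[OF fin(1)] that by simp
  have finU: "finite U" using U(1) finV finite_subset by blast
  have ins: "\<phi> (insert v S) = \<phi> S + 6 * int (card (nbrs E S v)) - 2 * int (card S) - 2 - 12 * int k"
    if "finite S" "v \<notin> S" for v S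
    using card_edges_in_insert[OF G that] that
    by (simp add: \<phi>_def power2_eq_square algebra_simps)
  have deg_in: "card U + 6 * k \<le> 3 * card (nbrs E U v)" if v: "v \<in> U" for v
  proof -
    have "nbrs E (U - {v}) v = nbrs E U v" using graph_irrefl[OF G] by (auto simp: nbrs_def)
    moreover have "card U = card (U - {v}) + 1" using card_Suc_Diff1[OF finU v] by simp
    moreover have "\<phi> U = \<phi> (insert v (U - {v}))" using v by (simp add: insert_absorb)
    moreover have "\<phi> (U - {v}) \<le> \<phi> U" using max U(1) by blast
    ultimately show ?thesis using ins[of "U - {v}" v] finU by auto
  qed
  have deg_out: "3 * card (nbrs E U v) \<le> card U + 1 + 6 * k" if v: "v \<in> V - U" for v
    using max[of "insert v U"] ins[of U v] finU U(1) v by auto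
  interpret core V E k U
    using U(1) deg_in by unfold_locales auto
  obtain col where col: "\<And>x y. x \<in> U \<Longrightarrow> y \<in> U \<Longrightarrow> adj E x y \<Longrightarrow> col x \<noteq> (col y :: bool)"
    using core_bipartite by blast
  \<comment> \<open>Otherwise \<open>V\<close> beats \<open>U\<close>: twice the value is about n^2
    - 36nk or more for \<open>V\<close>, but at most about n^2 - 38nk for a bipartite
    \<open>U\<close> with n - 7k vertices.\<close>
  have "card (V - U) < 7 * k"
  proof (rule ccontr)
    assume "\<not> ?thesis"
    define n u K where "n = int (card V)" and "u = int (card U)" and "K = int k"
    have nu: "u \<le> n - 7 * K" "0 \<le> u" "100 * K \<le> n" "2 \<le> K"
      using \<open>\<not> card (V - U) < 7 * k\<close> big k card_mono[OF finV U(1)] finU U(1)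
      by (auto simp: n_def u_def K_def card_Diff_subset)
    have "4 * card (edges_in E U) \<le> (card U)\<^sup>2"
      using card_edges_bipartite[OF U(1), where c = col] col by fastforce
    then have "4 * int (card (edges_in E U)) \<le> u\<^sup>2"
      unfolding u_def by (metis of_nat_le_iff of_nat_mult of_nat_numeral of_nat_power)
    then have hiU: "2 * \<phi> U \<le> u\<^sup>2 - 2 * u - 24 * (K * u)"
      by (simp add: \<phi>_def u_def K_def)
    define m where "m = card V - (2 * k - 1)"
    have m: "int m = n - 2 * K + 1" using big k by (simp add: m_def n_def K_def of_nat_diff)
    have ch: "2 * k choose 2 = k * (2 * k - 1)" by (simp add: choose_two)
    \<comment> \<open>The summand 3 is the loss from rounding down the quotient by 4.\<close>
    have "m\<^sup>2 + 4 * (k * (2 * k - 1)) \<le> 4 * card E + 3"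
      using many ch k by (simp add: edge_bound_def m_def)
    then have "int (m\<^sup>2 + 4 * (k * (2 * k - 1))) \<le> int (4 * card E + 3)" by linarith
    then have loE: "(n - 2 * K + 1)\<^sup>2 + 4 * (K * (2 * K - 1)) \<le> 4 * int (card E) + 3"
      using k by (simp add: m K_def of_nat_diff)
    have "2 * \<phi> V = 12 * int (card E) - 2 * n\<^sup>2 - 2 * n - 24 * (K * n)"
      using edges_in_V by (simp add: \<phi>_def n_def K_def)
    then have "3 * ((n - 2 * K + 1)\<^sup>2 + 4 * (K * (2 * K - 1))) - 9 - 2 * n\<^sup>2 - 2 * n - 24 * (K * n)
        \<le> u\<^sup>2 - 2 * u - 24 * (K * u)"
      using loE hiU max[of V] by simp
    \<comment> \<open>The product is monotone in u only while its second factor is nonnegative; for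
      smaller u it is at most 0.\<close>
    moreover have "u * (u - 2 - 24 * K) \<le> (n - 7 * K) * (n - 7 * K - 2 - 24 * K)"
    proof (cases "0 \<le> u - 2 - 24 * K")
      case True
      then show ?thesis using nu by (intro mult_mono) auto
    next
      case False
      then have "u * (u - 2 - 24 * K) \<le> 0" using nu by (intro mult_nonneg_nonpos) auto
      also have "0 \<le> (n - 7 * K) * (n - 7 * K - 2 - 24 * K)" using nu by (intro mult_nonneg_nonneg) auto
      finally show ?thesis .
    qed
    moreover have "100 * (K * K) \<le> K * n" "2 * K \<le> K * K"
      using nu mult_left_mono[of "100 * K" n K] mult_right_mono[of 2 K K] by auto
    ultimately show False using nu by (simp add: power2_eq_square algebra_simps)
  qed
  then have "colored_core V E k U col"
    using col deg_out big by unfold_locales auto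
  then show ?thesis by blast
qed

end

section \<open>Combining the core, the ears and the edge counts\<close>

theorem theorem1p3:
  fixes V :: "'a set" and E :: "'a set set" and k r n :: nat
  assumes "k \<ge> 2" and "3 \<le> r" and "r \<le> 2 * k" and "n \<ge> 100 * k"
    and "graph V E" and "card V = n"
    and "\<not> has_cycle V E (2 * k + 1)"
    and "card E \<ge> (n - r + 1)\<^sup>2 div 4 + (r choose 2)"
  shows "G_family n r V E \<or> T_with_Kr n r V E"
proof -
  interpret odd_cycle_free V E k using assms by unfold_locales auto
  have "n - (r - 1) = n - r + 1" using assms by linarith
  then have many: "edge_bound (card V) (r - 1) \<le> card E"
    using assms by (simp add: edge_bound_def)
  \<comment> \<open>The core and the bad-ear count use the bound at 2k - 1, the weakest one in the
    range r <= 2k.\<close>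
  have "edge_bound (card V) (2 * k - 1) \<le> edge_bound (card V) (r - 1)"
  proof (cases "r = 2 * k")
    case False
    then have "r - 1 < 2 * k - 1" "3 * (2 * k - 1) + 2 \<le> card V" using assms by linarith+
    then show ?thesis using edge_bound_less less_imp_le by blast
  qed simp
  then have many': "edge_bound (card V) (2 * k - 1) \<le> card E" using many by linarith
  obtain U col where "colored_core V E k U col" using dense_core many' assms by blast
  then interpret colored_core V E k U col .
  have good_U: "ears_good U col"
  proof (rule ccontr)
    assume "\<not> ears_good U col"
    then have "\<exists>ms p q. ear U p ms q \<and> \<not> good col p ms q"
      unfolding ears_good_def by blast
    from exE_some[OF this] obtain ms where "\<exists>p q. ear U p ms q \<and> \<not> good col p ms q"
      "\<And>ms'. \<exists>p q. ear U p ms' q \<and> \<not> good col p ms' q \<Longrightarrow> length ms \<le> length ms'"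
      using ex_has_least_nat[of "\<lambda>ms. \<exists>p q. ear U p ms q \<and> \<not> good col p ms q" _ length] by blast
    then obtain p q where "shortest_bad p ms q"
      unfolding shortest_bad_def by (metis not_less)
    from few_edges_if_bad_ear[OF this] many' show False by simp
  qed
  then obtain B c where B: "U \<subseteq> B" "B \<subseteq> V" "ears_good B c" "\<forall>p ms q. ear B p ms q \<longrightarrow> ms = []"
    using ear_closure[OF good_U UV] by blast
  have "card (V - B) \<le> card (V - U)" using B(1) finV by (intro card_mono) auto
  then have small: "3 * card (V - B) + 2 \<le> card V" using out big k by linarith
  have "V \<noteq> V - B" using small finV by auto
  then have "B \<noteq> {}" by blast
  moreover have "r \<le> card V" using assms by linarith
  ultimately show ?thesis
    using structure_without_ears[OF B(2) ears_good_proper[OF B(3)] B(4) _ small \<open>3 \<le> r\<close> _ many]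
      \<open>card V = n\<close> by simp
qed

end
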